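(* Let $(F_t)_{t\in[0,1]}$ be an isotopy in $\mathrm{Diff}^1(\mathbb{R}^2)$ joining the identity to $F_1=F$. Assume that there exist two points $x,y\in\mathbb{R}^2$, $x\neq y$, such that $\mathrm{Linking}((F_t)_t,x,y)$ exists and equals $l\in\mathbb{R}$. Suppose that $\bigcup_{n\in\mathbb{N}}F^n([x,y])$ is relatively compact, where $[x,y]$ is the segment joining $x$ and $y$. Then there exists an $F$-invariant Borel probability measure $\mu$ on $\mathbb{R}^2$ such that $$\mathrm{Torsion}((F_t)_t,\mu)=l.$$ Moreover, there exist points of $\mathbb{R}^2$ whose torsion (exists and) is greater than or equal to $l$, and also points whose torsion (exists and) is smaller than or equal to $l$.
   Context: $\mathbb{R}^2$ carries the Euclidean metric, the standard trivialization and the counterclockwise orientation; $\mathbb{T}=\mathbb{R}/2\pi\mathbb{Z}$. An isotopy joining $\mathrm{Id}$ to $F$ is a path $(F_t)_{t\in[0,1]}$ in $\mathrm{Diff}^1(\mathbb{R}^2)$, continuous for the weak (compact-open) $C^1$ topology, with $F_0=\mathrm{Id}$ and $F_1=F$; it is extended to $t\ge0$ by $F_t=F_{\{t\}}\circ F^{\lfloor t\rfloor}$ ($\{t\}$ fractional part, $\lfloor t\rfloor$ integer part). $\theta(u,v)\in\mathbb{T}$ is the oriented angle from $u$ to $v$. For $z\in\mathbb{R}^2$, $\xi\neq0$ and $n\ge1$: $\mathrm{Torsion}_n((F_t)_t,z,\xi)=\frac1n(\tilde v(n)-\tilde v(0))$, where $\tilde v$ is any continuous lift to $\mathbb{R}$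 of $t\mapsto\theta((1,0),DF_t(z)\xi)$, $t\ge0$. If it converges as $n\to+\infty$ for some $\xi\ne0$, the limit is denoted $\mathrm{Torsion}((F_t)_t,z)$ (existence and value do not depend on $\xi$). For $x\ne y$: $\mathrm{Linking}_n((F_t)_t,x,y)=\frac1n(\tilde u(n)-\tilde u(0))$, where $\tilde u$ is any continuous lift of $t\mapsto\theta((1,0),F_t(y)-F_t(x))$, and $\mathrm{Linking}((F_t)_t,x,y)=\lim_{n\to+\infty}\mathrm{Linking}_n((F_t)_t,x,y)$ whenever the limit exists. For an $F$-invariant Borel probability measure $\mu$ such that either $\mu$ has compact support or the isotopy has compact support (the supports of all $F_t$, $t\in[0,1]$, lie in one compact set), $\mathrm{Torsion}((F_t)_t,\cdot)$ is defined $\mu$-almost everywhere and $\mu$-integrable, and $\mathrm{Torsion}((F_t)_t,\mu)=\int_{\mathbb{R}^2}\mathrm{Torsion}((F_t)_t,z)\,d\mu(z)$. *)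

theory Defs
  imports "HOL-Probability.Probability"
begin

type_synonym plane = "real ^ 2"

text \<open>Maps of class $C^1$ on the plane; \<^const>\<open>jacobian\<close> is the matrix of the derivative in the
  standard trivialization of the tangent bundle.\<close>

definition C1_map :: "(plane \<Rightarrow> plane) \<Rightarrow> bool" where
  "C1_map f \<longleftrightarrow> (\<forall>z. f differentiable (at z)) \<and> continuous_on UNIV (\<lambda>z. jacobian f (at z))"

definition Diff1 :: "(plane \<Rightarrow> plane) set" where
  "Diff1 = {f. bij f \<and> C1_map f \<and> C1_map (inv f)}"

definition C1_nbhd :: "(plane \<Rightarrow> plane) \<Rightarrow> plane set \<Rightarrow> real \<Rightarrow> (plane \<Rightarrow> plane) set" where
  "C1_nbhd f K e = {g \<in> Diff1. \<forall>z\<in>K. norm (g z - f z) < e \<and>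
                                    norm (jacobian g (at z) - jacobian f (at z)) < e}"

definition weak_C1_topology :: "(plane \<Rightarrow> plane) topology" where
  "weak_C1_topology = topology_generated_by {C1_nbhd f K e |f K e. f \<in> Diff1 \<and> compact K \<and> e > 0}"

text \<open>The underlying set of the topology is \<^const>\<open>Diff1\<close> (take \<open>K\<close> empty), so \<^const>\<open>pathin\<close>
  includes the requirement that every time-\<open>t\<close> map with \<open>t\<close> in the unit interval is in \<^const>\<open>Diff1\<close>.
  Values of \<open>Ft\<close> at times outside the unit interval are irrelevant throughout.\<close>

definition isotopy_from_id :: "(real \<Rightarrow> plane \<Rightarrow> plane) \<Rightarrow> (plane \<Rightarrow> plane) \<Rightarrow> bool" where
  "isotopy_from_id Ft F \<longleftrightarrow> pathin weak_C1_topology Ft \<and> Ft 0 = id \<and> Ft 1 = F"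

definition extend_isotopy :: "(real \<Rightarrow> plane \<Rightarrow> plane) \<Rightarrow> real \<Rightarrow> plane \<Rightarrow> plane" where
  "extend_isotopy Ft t = Ft (frac t) \<circ> (Ft 1 ^^ nat \<lfloor>t\<rfloor>)"

definition rotation_ccw :: "real \<Rightarrow> plane \<Rightarrow> plane" where
  "rotation_ccw a u = vector [cos a * u $ 1 - sin a * u $ 2, sin a * u $ 1 + cos a * u $ 2]"

text \<open>An element of $\mathbb{R}/2\pi\mathbb{Z}$ is represented by the corresponding coset, i.e. the
  set of all its real representatives. Meaningful for nonzero \<open>u\<close> and \<open>v\<close>.\<close>

definition oriented_angle :: "plane \<Rightarrow> plane \<Rightarrow> real set" where
  "oriented_angle u v = {a. sgn v = rotation_ccw a (sgn u)}"

definition angle_lift :: "(real \<Rightarrow> plane) \<Rightarrow> (real \<Rightarrow> real) \<Rightarrow> bool" where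
  "angle_lift w v \<longleftrightarrow> continuous_on {0..} v \<and> (\<forall>t\<ge>0. v t \<in> oriented_angle (vector [1, 0]) (w t))"

text \<open>If \<open>w\<close> is a continuous nowhere vanishing curve, a lift exists and two lifts differ by a constant,
  so the variation below does not depend on the lift.\<close>

definition angle_variation :: "(real \<Rightarrow> plane) \<Rightarrow> real \<Rightarrow> real" where
  "angle_variation w s = (THE d. \<exists>v. angle_lift w v \<and> d = v s - v 0)"

definition torsion_n :: "(real \<Rightarrow> plane \<Rightarrow> plane) \<Rightarrow> plane \<Rightarrow> plane \<Rightarrow> nat \<Rightarrow> real" where
  "torsion_n Ft z \<xi> n =
     angle_variation (\<lambda>t. jacobian (extend_isotopy Ft t) (at z) *v \<xi>) (real n) / real n"

definition has_torsion :: "(real \<Rightarrow> plane \<Rightarrow> plane) \<Rightarrow> plane \<Rightarrow> real \<Rightarrow> bool" where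
  "has_torsion Ft z \<tau> \<longleftrightarrow> (\<exists>\<xi>. \<xi> \<noteq> 0 \<and> (\<lambda>n. torsion_n Ft z \<xi> n) \<longlonglongrightarrow> \<tau>)"

definition torsion_exists :: "(real \<Rightarrow> plane \<Rightarrow> plane) \<Rightarrow> plane \<Rightarrow> bool" where
  "torsion_exists Ft z \<longleftrightarrow> (\<exists>\<tau>. has_torsion Ft z \<tau>)"

definition torsion :: "(real \<Rightarrow> plane \<Rightarrow> plane) \<Rightarrow> plane \<Rightarrow> real" where
  "torsion Ft z = (THE \<tau>. has_torsion Ft z \<tau>)"

definition linking_n :: "(real \<Rightarrow> plane \<Rightarrow> plane) \<Rightarrow> plane \<Rightarrow> plane \<Rightarrow> nat \<Rightarrow> real" where
  "linking_n Ft x y n =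
     angle_variation (\<lambda>t. extend_isotopy Ft t y - extend_isotopy Ft t x) (real n) / real n"

definition has_linking :: "(real \<Rightarrow> plane \<Rightarrow> plane) \<Rightarrow> plane \<Rightarrow> plane \<Rightarrow> real \<Rightarrow> bool" where
  "has_linking Ft x y l \<longleftrightarrow> (\<lambda>n. linking_n Ft x y n) \<longlonglongrightarrow> l"

definition invariant_borel_prob :: "(plane \<Rightarrow> plane) \<Rightarrow> plane measure \<Rightarrow> bool" where
  "invariant_borel_prob F \<mu> \<longleftrightarrow> sets \<mu> = sets borel \<and> prob_space \<mu> \<and> distr \<mu> borel F = \<mu>"

definition measure_support :: "plane measure \<Rightarrow> plane set" where
  "measure_support \<mu> = {z. \<forall>U. open U \<and> z \<in> U \<longrightarrow> emeasure \<mu> U > 0}"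

definition map_support :: "(plane \<Rightarrow> plane) \<Rightarrow> plane set" where
  "map_support f = closure {z. f z \<noteq> z}"

definition compactly_supported_isotopy :: "(real \<Rightarrow> plane \<Rightarrow> plane) \<Rightarrow> bool" where
  "compactly_supported_isotopy Ft \<longleftrightarrow> (\<exists>K. compact K \<and> (\<forall>t\<in>{0..1}. map_support (Ft t) \<subseteq> K))"

text \<open>The torsion of an invariant measure is only defined under one of the two compactness
  conditions; it is then the integral of an almost everywhere defined integrable function.
  All of this is part of the assertion that the torsion of \<open>\<mu>\<close> equals \<open>\<tau>\<close>.\<close>

definition has_measure_torsion :: "(real \<Rightarrow> plane \<Rightarrow> plane) \<Rightarrow> plane measure \<Rightarrow> real \<Rightarrow> bool" where
  "has_measure_torsion Ft \<mu> \<tau> \<longleftrightarrow>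
     (compact (measure_support \<mu>) \<or> compactly_supported_isotopy Ft) \<and>
     (AE z in \<mu>. torsion_exists Ft z) \<and>
     integrable \<mu> (torsion Ft) \<and>
     (\<integral>z. torsion Ft z \<partial>\<mu>) = \<tau>"

end

theory Submission
  imports Defs
begin

text \<open>
  The chords of the arc $F_t([x,y])$, together with its tangent vectors on the diagonal, form a
  continuous nowhere vanishing family, so their directions lift to real angles. A mean value theorem
  for these angles, which uses that the arc is embedded, yields at every time $n$ a point of $[x,y]$
  whose time-$n$ torsion in the direction $y - x$ equals the time-$n$ linking number of $x$ and $y$.
  Time-$n$ torsion is a Birkhoff sum over the map induced by $F$ on the unit tangent bundle. A weak
  limit of the empirical measures along these points is invariant and integrates the time-one torsion
  to $l$; Birkhoff's ergodic theorem turns this integral into that of the torsion, and the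
  projection to the plane is the required measure.
\<close>

section \<open>Birkhoff's ergodic theorem for bounded functions\<close>

text \<open>The mean value theorem has to hold for real angles. Rolle's theorem, applied to the
  distance from the line of a chord, only yields a tangent parallel to that chord, that is, an angle
  modulo \<open>pi\<close>; the missing multiple of \<open>pi\<close> could grow with
  \<open>n\<close>, and dividing by \<open>n\<close> would not remove it.

  The point found depends on \<open>n\<close>, so no single orbit is known to carry the value
  \<open>l\<close>; only averages over orbit segments with moving starting points do, and these are
  what a weak limit keeps. The limit is taken in the unit tangent bundle because the variation over
  one period depends on the direction, which the derivative carries along: for a fixed direction it
  is not additive along orbits of \<open>F\<close>. The direction can be forgotten at the end, since
  the variations of two directions at one point differ by at most \<open>pi\<close> at every time,
  so the limits of the averages depend on the base point alone.\<close>

definition birkhoff_sum :: "('a \<Rightarrow> 'a) \<Rightarrow> ('a \<Rightarrow> real) \<Rightarrow> nat \<Rightarrow> 'a \<Rightarrow> real" where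
  "birkhoff_sum T h n x = (\<Sum>i<n. h ((T ^^ i) x))"

lemma birkhoff_sum_0 [simp]: "birkhoff_sum T h 0 x = 0"
  by (simp add: birkhoff_sum_def)

lemma birkhoff_sum_Suc: "birkhoff_sum T h (Suc n) x = h x + birkhoff_sum T h n (T x)"
  unfolding birkhoff_sum_def by (subst sum.lessThan_Suc_shift) (simp add: funpow_swap1)

lemma measurable_birkhoff_sum [measurable]:
  assumes [measurable]: "T \<in> measurable M M" "h \<in> borel_measurable M"
  shows "birkhoff_sum T h n \<in> borel_measurable M"
proof (induction n)
  case 0
  have "birkhoff_sum T h 0 = (\<lambda>x. 0)" by (auto simp: birkhoff_sum_def)
  then show ?case by simp
next
  case (Suc n)
  note [measurable] = Suc
  have "birkhoff_sum T h (Suc n) = (\<lambda>x. h x + birkhoff_sum T h n (T x))"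
    by (simp add: birkhoff_sum_Suc fun_eq_iff)
  then show ?case by simp
qed

text \<open>The maximum of the Birkhoff sums of lengths 0 to \<open>n\<close>, in the recursive form
  that Garsia's argument uses.\<close>

fun garsia_max :: "('a \<Rightarrow> 'a) \<Rightarrow> ('a \<Rightarrow> real) \<Rightarrow> nat \<Rightarrow> 'a \<Rightarrow> real" where
  "garsia_max T h 0 x = 0"
| "garsia_max T h (Suc n) x = max 0 (h x + garsia_max T h n (T x))"

lemma garsia_max_nonneg: "0 \<le> garsia_max T h n x"
  by (cases n) auto

lemma garsia_max_Suc_ge: "garsia_max T h n x \<le> garsia_max T h (Suc n) x"
proof (induction n arbitrary: x)
  case 0
  show ?case using garsia_max_nonneg[of T h 1 x] by simp
next
  case (Suc n)
  show ?case using Suc[of "T x"] by auto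
qed

lemma garsia_max_mono: "m \<le> n \<Longrightarrow> garsia_max T h m x \<le> garsia_max T h n x"
  using lift_Suc_mono_le[of "\<lambda>n. garsia_max T h n x"] garsia_max_Suc_ge[of T h _ x] by blast

lemma birkhoff_sum_le_garsia_max: "birkhoff_sum T h n x \<le> garsia_max T h n x"
proof (induction n arbitrary: x)
  case (Suc n)
  show ?case using Suc[of "T x"] by (auto simp: birkhoff_sum_Suc)
qed simp

lemma measurable_garsia_max [measurable]:
  assumes [measurable]: "T \<in> measurable M M" "h \<in> borel_measurable M"
  shows "garsia_max T h n \<in> borel_measurable M"
proof (induction n)
  case 0
  have "garsia_max T h 0 = (\<lambda>x. 0)" by auto
  then show ?case by simp
next
  case (Suc n)
  note [measurable] = Suc
  have "garsia_max T h (Suc n) = (\<lambda>x. max 0 (h x + garsia_max T h n (T x)))"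
    by (simp add: fun_eq_iff)
  then show ?case by simp
qed

lemma garsia_max_le:
  assumes h: "\<And>x. x \<in> space M \<Longrightarrow> \<bar>h x\<bar> \<le> B" and T: "T \<in> measurable M M"
  shows "x \<in> space M \<Longrightarrow> garsia_max T h n x \<le> n * B"
proof (induction n arbitrary: x)
  case (Suc n)
  have "T x \<in> space M" using T Suc.prems by (auto dest: measurable_space)
  then have "garsia_max T h n (T x) \<le> n * B" by (rule Suc.IH)
  with h[OF Suc.prems] show ?case by (auto simp: algebra_simps intro: add_nonneg_nonneg)
qed simp

text \<open>Garsia's argument: where \<open>garsia_max\<close> is positive, \<open>h\<close> is at
  least its drop from \<open>x\<close> to \<open>T x\<close>; elsewhere that drop is at most 0. By
  invariance the drop integrates to 0, so \<open>h\<close> has nonnegative integral over the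
  positivity set, and by \<open>pos\<close> these sets exhaust the space.\<close>

lemma maximal_ergodic_inequality:
  assumes M: "finite_measure M" and T [measurable]: "T \<in> measurable M M" and inv: "distr M M T = M"
    and h [measurable]: "h \<in> borel_measurable M" and B: "\<And>x. x \<in> space M \<Longrightarrow> \<bar>h x\<bar> \<le> B"
    and pos: "\<And>x. x \<in> space M \<Longrightarrow> \<exists>n. birkhoff_sum T h n x > 0"
  shows "0 \<le> (\<integral>x. h x \<partial>M)"
proof -
  interpret finite_measure M by fact
  define g where "g = garsia_max T h"
  have gm [measurable]: "g n \<in> borel_measurable M" for n unfolding g_def by measurable
  define E where "E n = {x \<in> space M. g n x > 0}" for n
  have Em [measurable]: "E n \<in> sets M" for n unfolding E_def by measurable
  have gi: "integrable M (g n)" for n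
    by (rule integrable_const_bound[where B = "n * B"])
       (auto simp: g_def garsia_max_nonneg intro: garsia_max_le[OF B T])
  have giT: "integrable M (\<lambda>x. g n (T x))" for n
    by (rule integrable_distr[OF T]) (simp add: inv gi)
  have hi: "integrable M h"
    by (rule integrable_const_bound[where B = B]) (auto intro: B)
  have hiE: "integrable M (\<lambda>x. indicator (E n) x * h x)" for n
    using integrable_mult_indicator[OF Em hi] by simp
  have ineq: "g (Suc n) x - g (Suc n) (T x) \<le> indicator (E (Suc n)) x * h x" if "x \<in> space M" for n x
  proof (cases "g (Suc n) x > 0")
    case True
    then have "g (Suc n) x = h x + g n (T x)" by (auto simp: g_def split: if_splits)
    also have "\<dots> \<le> h x + g (Suc n) (T x)" unfolding g_def using garsia_max_Suc_ge by auto
    finally show ?thesis using True that by (simp add: E_def)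
  next
    case False
    then have "g (Suc n) x = 0" using garsia_max_nonneg[of T h "Suc n" x] by (simp add: g_def)
    then show ?thesis using False garsia_max_nonneg[of T h "Suc n" "T x"] by (simp add: E_def g_def)
  qed
  have nn: "0 \<le> (\<integral>x. indicator (E (Suc n)) x * h x \<partial>M)" for n
  proof -
    have "(\<integral>x. g (Suc n) (T x) \<partial>M) = (\<integral>x. g (Suc n) x \<partial>distr M M T)"
      by (rule integral_distr[symmetric]) auto
    then have "0 = (\<integral>x. g (Suc n) x - g (Suc n) (T x) \<partial>M)"
      using gi giT by (simp add: inv)
    also have "\<dots> \<le> (\<integral>x. indicator (E (Suc n)) x * h x \<partial>M)"
      by (rule integral_mono) (use gi giT hiE ineq in auto)
    finally show ?thesis .
  qed
  have "(\<lambda>n. \<integral>x. indicator (E (Suc n)) x * h x \<partial>M) \<longlonglongrightarrow> (\<integral>x. h x \<partial>M)"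
  proof (rule integral_dominated_convergence[where w = "\<lambda>_. B"])
    show "AE x in M. (\<lambda>n. indicator (E (Suc n)) x * h x) \<longlonglongrightarrow> h x"
    proof (rule AE_I2)
      fix x assume x: "x \<in> space M"
      obtain N where N: "birkhoff_sum T h N x > 0" using pos[OF x] by blast
      have "indicator (E (Suc n)) x * h x = h x" if "n \<ge> N" for n
      proof -
        have "0 < g N x" using N birkhoff_sum_le_garsia_max[of T h N x] by (simp add: g_def)
        also have "\<dots> \<le> g (Suc n) x" unfolding g_def using that by (intro garsia_max_mono) auto
        finally show ?thesis using x by (simp add: E_def)
      qed
      then show "(\<lambda>n. indicator (E (Suc n)) x * h x) \<longlonglongrightarrow> h x"
        by (intro tendsto_eventually eventually_sequentiallyI)
    qed
    show "AE x in M. norm (indicator (E (Suc n)) x * h x) \<le> B" for n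
    proof (rule AE_I2)
      fix x assume "x \<in> space M"
      from B[OF this] show "norm (indicator (E (Suc n)) x * h x) \<le> B"
        by (auto simp: indicator_def)
    qed
  qed auto
  then show ?thesis using nn by (intro LIMSEQ_le_const) auto
qed

section \<open>From the maximal inequality to Birkhoff's theorem\<close>

lemma birkhoff_sum_invariant:
  assumes "\<And>y. c (T y) = c y"
  shows "birkhoff_sum T (\<lambda>y. h y + c y) n x = birkhoff_sum T h n x + n * c x"
proof -
  have "c ((T ^^ i) x) = c x" for i by (induction i) (auto simp: assms)
  then show ?thesis by (simp add: birkhoff_sum_def sum.distrib)
qed

lemma birkhoff_sum_abs_le:
  assumes "\<And>y. \<bar>h y\<bar> \<le> B"
  shows "\<bar>birkhoff_sum T h n x\<bar> \<le> n * B"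
  unfolding birkhoff_sum_def using sum_norm_bound[of "{..<n}" "\<lambda>i. h ((T ^^ i) x)" B] assms by simp

text \<open>The limsup is formed in \<open>ereal\<close>, where it always exists; for bounded
  \<open>h\<close> it is finite and the conversion loses nothing.\<close>

definition birkhoff_limsup :: "('a \<Rightarrow> 'a) \<Rightarrow> ('a \<Rightarrow> real) \<Rightarrow> 'a \<Rightarrow> real" where
  "birkhoff_limsup T h x = real_of_ereal (limsup (\<lambda>n. ereal (birkhoff_sum T h n x / n)))"

context
  fixes T :: "'a \<Rightarrow> 'a" and h :: "'a \<Rightarrow> real" and B :: real
  assumes B: "\<And>y. \<bar>h y\<bar> \<le> B"
begin

lemma birkhoff_average_abs_le: "\<bar>birkhoff_sum T h n x / n\<bar> \<le> B"
proof (cases "n = 0")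
  case True
  then show ?thesis using B[of x] by simp
next
  case False
  then show ?thesis using birkhoff_sum_abs_le[where T = T and h = h and n = n and x = x, OF B] by (simp add: field_simps)
qed

lemma ereal_birkhoff_limsup:
  "ereal (birkhoff_limsup T h x) = limsup (\<lambda>n. ereal (birkhoff_sum T h n x / n))"
  and birkhoff_limsup_abs_le: "\<bar>birkhoff_limsup T h x\<bar> \<le> B"
proof -
  let ?L = "limsup (\<lambda>n. ereal (birkhoff_sum T h n x / n))"
  have avg: "birkhoff_sum T h n x / n \<le> B" "- B \<le> birkhoff_sum T h n x / n" for n
    using birkhoff_average_abs_le[of n x] unfolding abs_le_iff by linarith+
  have 1: "?L \<le> ereal B"
    by (rule Limsup_bounded) (simp add: avg)
  have "ereal (- B) \<le> liminf (\<lambda>n. ereal (birkhoff_sum T h n x / n))"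
    by (rule Liminf_bounded) (simp add: avg)
  also have "\<dots> \<le> ?L" by (rule Liminf_le_Limsup) simp
  finally have 2: "ereal (- B) \<le> ?L" .
  show "ereal (birkhoff_limsup T h x) = ?L"
    unfolding birkhoff_limsup_def using 1 2 by (cases ?L) auto
  then show "\<bar>birkhoff_limsup T h x\<bar> \<le> B" using 1 2
    by (metis abs_le_iff ereal_less_eq(3) minus_le_iff)
qed

lemma birkhoff_limsup_invariant: "birkhoff_limsup T h (T x) = birkhoff_limsup T h x"
proof -
  define a where "a n = birkhoff_sum T h n (T x) / n - birkhoff_sum T h (Suc n) x / Suc n" for n
  have "a \<longlonglongrightarrow> 0"
  proof (rule Lim_null_comparison)
    show "(\<lambda>n. 2 * B / n) \<longlonglongrightarrow> 0" by real_asymp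
    show "\<forall>\<^sub>F n in sequentially. norm (a n) \<le> 2 * B / n"
    proof (rule eventually_sequentiallyI[of 1])
      fix n :: nat assume n: "1 \<le> n"
      \<comment> \<open>The sum along \<open>T x\<close> only loses the term \<open>h x\<close>, so
        the numerator is a difference of two numbers bounded by \<open>B\<close>.\<close>
      have "a n = (birkhoff_sum T h (Suc n) x / Suc n - h x) / n"
        using n by (simp add: a_def birkhoff_sum_Suc field_simps)
      moreover have "\<bar>birkhoff_sum T h (Suc n) x / Suc n - h x\<bar> \<le> 2 * B"
        using birkhoff_average_abs_le[of "Suc n" x] B[of x] by linarith
      ultimately show "norm (a n) \<le> 2 * B / n"
        by (simp add: divide_right_mono del: of_nat_Suc)
    qed
  qed
  then have a: "(\<lambda>n. ereal (a n)) \<longlonglongrightarrow> 0" by (simp add: zero_ereal_def)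
  have "limsup (\<lambda>n. ereal (birkhoff_sum T h n (T x) / n))
      = limsup (\<lambda>n. ereal (a n) + ereal (birkhoff_sum T h (Suc n) x / Suc n))"
    by (simp add: a_def)
  also have "\<dots> = 0 + limsup (\<lambda>n. ereal (birkhoff_sum T h (Suc n) x / Suc n))"
    by (rule ereal_limsup_lim_add[OF a]) auto
  also have "\<dots> = limsup (\<lambda>n. ereal (birkhoff_sum T h n x / n))"
    using limsup_shift[of "\<lambda>n. ereal (birkhoff_sum T h n x / n)"] by simp
  finally show ?thesis by (simp add: birkhoff_limsup_def)
qed

text \<open>As the limsup is invariant, subtracting it from \<open>h + e\<close> changes the
  \<open>n\<close>-th Birkhoff sum by a multiple of \<open>n\<close> only. At every point some sum
  becomes positive, because the averages of \<open>h\<close> exceed the limsup minus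
  \<open>e\<close> infinitely often. So the maximal inequality applies, for every
  \<open>e\<close>.\<close>

lemma integral_birkhoff_limsup_le:
  assumes M: "prob_space M" and T [measurable]: "T \<in> measurable M M" and inv: "distr M M T = M"
    and h [measurable]: "h \<in> borel_measurable M"
  shows "(\<integral>x. birkhoff_limsup T h x \<partial>M) \<le> (\<integral>x. h x \<partial>M)"
proof (rule field_le_epsilon)
  fix e :: real assume e: "e > 0"
  interpret prob_space M by fact
  let ?L = "birkhoff_limsup T h"
  have Lm [measurable]: "?L \<in> borel_measurable M" unfolding birkhoff_limsup_def by measurable
  have hi: "integrable M h" by (rule integrable_const_bound[where B = B]) (auto intro: B)
  have Li: "integrable M ?L"
    by (rule integrable_const_bound[where B = B]) (auto intro: birkhoff_limsup_abs_le)
  have "0 \<le> (\<integral>x. h x + (e - ?L x) \<partial>M)"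
  proof (rule maximal_ergodic_inequality[OF finite_measure_axioms T inv, where B = "2 * B + e"])
    show "\<bar>h x + (e - ?L x)\<bar> \<le> 2 * B + e" for x
      using B[of x] birkhoff_limsup_abs_le[of x] e by linarith
    show "\<exists>n. birkhoff_sum T (\<lambda>x. h x + (e - ?L x)) n x > 0" for x
    proof -
      have "ereal (?L x - e) < limsup (\<lambda>n. ereal (birkhoff_sum T h n x / n))"
        using e by (simp flip: ereal_birkhoff_limsup)
      then have "\<exists>\<^sub>F n in sequentially. ereal (?L x - e) < ereal (birkhoff_sum T h n x / n)"
        using Limsup_bounded[of "\<lambda>n. ereal (birkhoff_sum T h n x / n)" "ereal (?L x - e)" sequentially]
        unfolding frequently_def not_less[symmetric] by (auto simp: not_less)
      \<comment> \<open>Infinitely many \<open>n\<close> qualify, hence one with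
        \<open>n >= 1\<close>; at \<open>n = 0\<close> the quotient is the default value 0 and says
        nothing.\<close>
      then obtain n where n: "n \<ge> 1" "?L x - e < birkhoff_sum T h n x / n"
        unfolding frequently_sequentially by (meson less_ereal.simps(1))
      have "birkhoff_sum T (\<lambda>x. h x + (e - ?L x)) n x = birkhoff_sum T h n x + n * (e - ?L x)"
        by (rule birkhoff_sum_invariant) (simp add: birkhoff_limsup_invariant)
      also have "\<dots> > 0" using n by (simp add: field_simps)
      finally show ?thesis by blast
    qed
  qed auto
  also have "\<dots> = (\<integral>x. h x \<partial>M) + e - (\<integral>x. ?L x \<partial>M)"
    using hi Li by (simp add: prob_space)
  finally show "(\<integral>x. ?L x \<partial>M) \<le> (\<integral>x. h x \<partial>M) + e" by simp
qed

end

text \<open>The previous bound, used for \<open>h\<close> and for \<open>- h\<close>, puts the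
  integral of \<open>h\<close> above that of the limsup and below that of the liminf. As the liminf
  is the smaller function, the two agree almost everywhere.\<close>

theorem birkhoff_ergodic_bounded:
  assumes M: "prob_space M" and T [measurable]: "T \<in> measurable M M" and inv: "distr M M T = M"
    and h [measurable]: "h \<in> borel_measurable M" and B: "\<And>x. \<bar>h x\<bar> \<le> B"
  obtains L where "L \<in> borel_measurable M" "\<And>x. \<bar>L x\<bar> \<le> B"
    "AE x in M. (\<lambda>n. birkhoff_sum T h n x / n) \<longlonglongrightarrow> L x" "(\<integral>x. L x \<partial>M) = (\<integral>x. h x \<partial>M)"
proof -
  interpret prob_space M by fact
  let ?U = "birkhoff_limsup T h" and ?V = "\<lambda>x. - birkhoff_limsup T (\<lambda>y. - h y) x"
  have B': "\<And>x. \<bar>- h x\<bar> \<le> B" using B by simp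
  have V: "ereal (?V x) = liminf (\<lambda>n. ereal (birkhoff_sum T h n x / n))" for x
  proof -
    have "ereal (birkhoff_limsup T (\<lambda>y. - h y) x) = limsup (\<lambda>n. - ereal (birkhoff_sum T h n x / n))"
      using ereal_birkhoff_limsup[where h = "\<lambda>y. - h y" and B = B, OF B', where T = T and x = x] by (simp add: birkhoff_sum_def sum_negf)
    then show ?thesis by (simp add: ereal_Limsup_uminus flip: uminus_ereal.simps(1))
  qed
  note U = ereal_birkhoff_limsup[OF B, where T = T]
  have VU: "?V x \<le> ?U x" for x
    using Liminf_le_Limsup[of sequentially "\<lambda>n. ereal (birkhoff_sum T h n x / n)"]
    by (simp flip: U V)
  have VU': "0 \<le> ?U x + birkhoff_limsup T (\<lambda>y. - h y) x" for x
    using VU[of x] by linarith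
  have m [measurable]: "?U \<in> borel_measurable M" "?V \<in> borel_measurable M"
    unfolding birkhoff_limsup_def by measurable
  have bU: "\<bar>?U x\<bar> \<le> B" and bV: "\<bar>?V x\<bar> \<le> B" for x
    using birkhoff_limsup_abs_le[where h = h, OF B, where T = T and x = x]
      birkhoff_limsup_abs_le[where h = "\<lambda>y. - h y" and B = B, OF B', where T = T and x = x] by auto
  have i: "integrable M ?U" "integrable M ?V"
    by (rule integrable_const_bound[where B = B], use bU in simp, rule m)
       (rule integrable_const_bound[where B = B], use bV in simp, rule m)
  have 1: "(\<integral>x. ?U x \<partial>M) \<le> (\<integral>x. h x \<partial>M)"
    by (rule integral_birkhoff_limsup_le[OF B M T inv h])
  have "(\<integral>x. birkhoff_limsup T (\<lambda>y. - h y) x \<partial>M) \<le> (\<integral>x. - h x \<partial>M)"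
    by (rule integral_birkhoff_limsup_le[OF B' M T inv]) simp
  then have 2: "(\<integral>x. h x \<partial>M) \<le> (\<integral>x. ?V x \<partial>M)" by simp
  have 3: "(\<integral>x. ?V x \<partial>M) \<le> (\<integral>x. ?U x \<partial>M)" by (rule integral_mono[OF i(2,1)]) (rule VU)
  have "(\<integral>x. ?U x - ?V x \<partial>M) = 0" using 1 2 3 i by simp
  then have "AE x in M. ?U x - ?V x = 0"
    by (subst (asm) integral_nonneg_eq_0_iff_AE) (use i VU' in auto)
  then have "AE x in M. (\<lambda>n. birkhoff_sum T h n x / n) \<longlonglongrightarrow> ?U x"
  proof eventually_elim
    case (elim x)
    then have eq: "?V x = ?U x" by simp
    have "(\<lambda>n. ereal (birkhoff_sum T h n x / n)) \<longlonglongrightarrow> ereal (?U x)"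
      by (rule Liminf_eq_Limsup) (use U V[of x] in \<open>auto simp: eq\<close>)
    then show ?case by simp
  qed
  then show thesis using that[of ?U] m bU 1 2 3 by auto
qed

section \<open>Empirical measures on compact sets\<close>

text \<open>Schoenberg's function: continuous, even, of period 2. The cosine is 1/2 at pi/3 and -1/2
  at 2 pi/3, so clipping gives exactly 0 on [0, 1/3] and 1 on [2/3, 1].\<close>

definition schoenberg_wave :: "real \<Rightarrow> real" where
  "schoenberg_wave x = max 0 (min 1 (1/2 - cos (pi * x)))"

lemma schoenberg_wave_bounds: "0 \<le> schoenberg_wave x" "schoenberg_wave x \<le> 1"
  by (auto simp: schoenberg_wave_def)

lemma schoenberg_wave_eq_0: "0 \<le> x \<Longrightarrow> x \<le> 1/3 \<Longrightarrow> schoenberg_wave x = 0"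
proof -
  assume "0 \<le> x" "x \<le> 1/3"
  then have "cos (pi / 3) \<le> cos (pi * x)" by (intro cos_monotone_0_pi_le) auto
  then show ?thesis by (simp add: schoenberg_wave_def cos_60)
qed

lemma schoenberg_wave_eq_1: "2/3 \<le> x \<Longrightarrow> x \<le> 1 \<Longrightarrow> schoenberg_wave x = 1"
proof -
  assume "2/3 \<le> x" "x \<le> 1"
  then have "cos (pi * x) \<le> cos (pi * (2/3))" by (intro cos_monotone_0_pi_le) auto
  moreover have "cos (pi * (2/3)) = - 1 / 2" using cos_120 by (simp add: mult.commute)
  ultimately show ?thesis by (simp add: schoenberg_wave_def)
qed

text \<open>For \<open>d\<close> with values 0 and 1 this is the point of the Cantor set with
  ternary digits \<open>2 * d k\<close>.\<close>

definition cantor_point :: "(nat \<Rightarrow> real) \<Rightarrow> real" where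
  "cantor_point d = (\<Sum>k. 2 * d k / 3 ^ Suc k)"

lemma cantor_series:
  assumes "\<And>k. d k \<in> {0, 1}"
  shows "summable (\<lambda>k. 2 * d k / 3 ^ Suc k :: real)" "0 \<le> cantor_point d" "cantor_point d \<le> 1"
    "3 * cantor_point d = 2 * d 0 + cantor_point (\<lambda>k. d (Suc k))"
proof -
  have geo: "(\<lambda>k. 2 / 3 ^ Suc k :: real) sums 1"
    using sums_mult[OF geometric_sums[of "1/3::real"], of "2/3"] by (simp add: power_one_over field_simps)
  have d: "0 \<le> d k" "d k \<le> 1" for k using assms[of k] by auto
  have le: "2 * d k / 3 ^ Suc k \<le> 2 / 3 ^ Suc k" for k
    using d[of k] by (simp add: divide_right_mono)
  show s: "summable (\<lambda>k. 2 * d k / 3 ^ Suc k)"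
    by (rule summable_comparison_test[OF _ sums_summable[OF geo]])
       (use d le in \<open>auto simp del: power_Suc intro!: exI[of _ 0]\<close>)
  show "0 \<le> cantor_point d" unfolding cantor_point_def by (rule suminf_nonneg[OF s]) (use d in auto)
  show "cantor_point d \<le> 1"
    unfolding cantor_point_def sums_unique[OF geo]
    by (rule suminf_le[OF _ s sums_summable[OF geo]]) (use le in blast)
  have s': "summable (\<lambda>k. 2 * d (Suc k) / 3 ^ Suc (Suc k))"
    using s by (subst summable_Suc_iff)
  have "cantor_point d = 2 * d 0 / 3 + (\<Sum>k. 2 * d (Suc k) / 3 ^ Suc (Suc k))"
    unfolding cantor_point_def using suminf_split_head[OF s] by simp
  moreover have "cantor_point (\<lambda>k. d (Suc k)) = 3 * (\<Sum>k. 2 * d (Suc k) / 3 ^ Suc (Suc k))"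
    unfolding cantor_point_def by (subst suminf_mult[OF s', symmetric]) simp
  ultimately show "3 * cantor_point d = 2 * d 0 + cantor_point (\<lambda>k. d (Suc k))" by simp
qed

text \<open>Multiplication by 3 shifts the ternary digits and splits off the even integer
  \<open>2 * d 0\<close>, invisible to a function of period 2. So digit \<open>n\<close> moves to
  the front, where 0 puts the point into [0, 1/3] and 2 puts it into [2/3, 1].\<close>

lemma schoenberg_wave_cantor_point:
  assumes "\<And>k. d k \<in> {0, 1}"
  shows "schoenberg_wave (3 ^ n * cantor_point d) = d n"
  using assms
proof (induction n arbitrary: d)
  case 0
  have b: "0 \<le> cantor_point (\<lambda>k. d (Suc k))" "cantor_point (\<lambda>k. d (Suc k)) \<le> 1"
    using cantor_series[of "\<lambda>k. d (Suc k)"] 0 by auto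
  have eq: "3 * cantor_point d = 2 * d 0 + cantor_point (\<lambda>k. d (Suc k))"
    using cantor_series(4)[of d] 0 by blast
  show ?case
    using 0[of 0] b eq by (auto simp: schoenberg_wave_eq_0 schoenberg_wave_eq_1)
next
  case (Suc n)
  have eq: "3 * cantor_point d = 2 * d 0 + cantor_point (\<lambda>k. d (Suc k))"
    using cantor_series(4)[of d] Suc.prems by blast
  have "3 ^ Suc n * cantor_point d = 3 ^ n * (3 * cantor_point d)" by simp
  also have "\<dots> = 3 ^ n * cantor_point (\<lambda>k. d (Suc k)) + 2 * (3 ^ n * d 0)"
    unfolding eq by (simp add: algebra_simps)
  finally have e: "3 ^ Suc n * cantor_point d = 3 ^ n * cantor_point (\<lambda>k. d (Suc k)) + 2 * (3 ^ n * d 0)" .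
  obtain m :: nat where "3 ^ n * d 0 = real m"
    using Suc.prems[of 0] by (auto intro: that[of 0] that[of "3 ^ n"])
  then have "cos (pi * (3 ^ Suc n * cantor_point d)) = cos (pi * (3 ^ n * cantor_point (\<lambda>k. d (Suc k))) + 2 * real m * pi)"
    unfolding e by (simp add: algebra_simps)
  also have "\<dots> = cos (pi * (3 ^ n * cantor_point (\<lambda>k. d (Suc k))))"
    by (simp only: cos_add cos_2npi sin_2npi)
  finally have "schoenberg_wave (3 ^ Suc n * cantor_point d) = schoenberg_wave (3 ^ n * cantor_point (\<lambda>k. d (Suc k)))"
    by (simp only: schoenberg_wave_def)
  then show ?case using Suc.IH[of "\<lambda>k. d (Suc k)"] Suc.prems by simp
qed

lemma binary_expansion:
  fixes c :: real
  assumes "0 \<le> c" "c \<le> 1"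
  obtains d where "\<And>k. d k \<in> {0, 1 :: real}" "(\<lambda>k. d k / 2 ^ Suc k) sums c"
proof -
  \<comment> \<open>The orbit of \<open>c\<close> under doubling; \<open>r n / 2 ^ n\<close> is the
    error after \<open>n\<close> digits. The value 1 is fixed and keeps producing the digit 1, which
    covers \<open>c = 1\<close>.\<close>
  define r where "r = rec_nat c (\<lambda>_ x. if x \<ge> 1/2 then 2 * x - 1 else 2 * x)"
  define d where "d k = (if r k \<ge> 1/2 then 1 else 0 :: real)" for k
  have r0: "r 0 = c" and rS: "r (Suc n) = 2 * r n - d n" for n
    by (simp_all add: r_def d_def)
  have r: "0 \<le> r n \<and> r n \<le> 1" for n
    by (induction n) (auto simp: r0 rS d_def assms)
  have "(\<Sum>k<n. d k / 2 ^ Suc k) = c - r n / 2 ^ n" for n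
    by (induction n) (auto simp: r0 rS field_simps)
  moreover have "(\<lambda>n. r n / 2 ^ n) \<longlonglongrightarrow> 0"
  proof (rule Lim_null_comparison)
    show "(\<lambda>n. 1 / 2 ^ n :: real) \<longlonglongrightarrow> 0" by real_asymp
    show "\<forall>\<^sub>F n in sequentially. norm (r n / 2 ^ n) \<le> 1 / 2 ^ n"
      using r by (auto intro!: always_eventually divide_right_mono)
  qed
  ultimately have "(\<lambda>k. d k / 2 ^ Suc k) sums c"
    unfolding sums_def using tendsto_diff[of "\<lambda>_. c" c sequentially "\<lambda>n. r n / 2 ^ n" 0] by simp
  then show thesis using that[of d] by (auto simp: d_def)
qed

text \<open>Schoenberg's space-filling curve: the coordinates are read off from interleaved ternary digits.\<close>

theorem space_filling_curve:
  fixes C :: "'a::euclidean_space set"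
  assumes "bounded C"
  obtains q :: "real \<Rightarrow> 'a" where "continuous_on UNIV q" "bounded (range q)" "C \<subseteq> q ` {0..1}"
proof -
  obtain R where R: "R > 0" "\<And>x. x \<in> C \<Longrightarrow> norm x \<le> R"
    using assms bounded_pos by metis
  obtain idx :: "'a \<Rightarrow> nat" where idx: "bij_betw idx Basis {..<DIM('a)}"
    using ex_bij_betw_finite_nat[of "Basis::'a set"] by (auto simp: atLeast0LessThan)
  \<comment> \<open>Coordinate \<open>b\<close> takes every \<open>DIM('a)\<close>-th ternary digit,
    from position \<open>idx b\<close> on, as its binary digits. The terms are dominated by a
    geometric series, so \<open>w b\<close> is continuous on the whole line.\<close>
  define w where "w b t = (\<Sum>k. schoenberg_wave (3 ^ (DIM('a) * k + idx b) * t) / 2 ^ Suc k)" for b :: 'a and t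
  have geo: "(\<lambda>k. 1 / 2 ^ Suc k :: real) sums 1" by (rule power_half_series[unfolded power_one_over])
  have le: "schoenberg_wave s / 2 ^ Suc k \<le> 1 / 2 ^ Suc k" for s k
    using schoenberg_wave_bounds[of s] by (intro divide_right_mono) auto
  have bd: "norm (schoenberg_wave s / 2 ^ Suc k) \<le> 1 / 2 ^ Suc k" for s k
    using schoenberg_wave_bounds[of s] by (simp add: divide_right_mono)
  have sw: "summable (\<lambda>k. schoenberg_wave (3 ^ (DIM('a) * k + idx b) * t) / 2 ^ Suc k)" for b t
    by (rule summable_comparison_test[OF _ sums_summable[OF geo]]) (use bd in blast)
  have w: "0 \<le> w b t" "w b t \<le> 1" for b t
    unfolding w_def
    by (rule suminf_nonneg[OF sw], simp add: schoenberg_wave_bounds)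
       (subst sums_unique[OF geo], intro suminf_le le sw sums_summable[OF geo])
  have cw: "continuous_on UNIV (w b)" for b
  proof -
    have "uniform_limit UNIV (\<lambda>n t. \<Sum>k<n. schoenberg_wave (3 ^ (DIM('a) * k + idx b) * t) / 2 ^ Suc k) (w b) sequentially"
      unfolding w_def by (rule Weierstrass_m_test[OF bd sums_summable[OF geo]])
    then show ?thesis
      by (rule uniform_limit_theorem[rotated])
         (auto intro!: always_eventually continuous_intros simp: schoenberg_wave_def)
  qed
  define q where "q t = (\<Sum>b\<in>Basis. (R * (2 * w b t - 1)) *\<^sub>R b)" for t
  show thesis
  proof
    show "continuous_on UNIV q" unfolding q_def by (intro continuous_intros cw)
    have "norm (q t) \<le> (\<Sum>b\<in>(Basis::'a set). R)" for t
      unfolding q_def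
    proof (rule sum_norm_le)
      fix b :: 'a assume "b \<in> Basis"
      have "\<bar>2 * w b t - 1\<bar> \<le> 1" using w[of b t] by (simp add: abs_le_iff)
      then show "norm ((R * (2 * w b t - 1)) *\<^sub>R b) \<le> R"
        using R(1) \<open>b \<in> Basis\<close> by (simp add: abs_mult mult_left_le)
    qed
    then show "bounded (range q)" unfolding bounded_iff by blast
    show "C \<subseteq> q ` {0..1}"
    proof
      fix x assume x: "x \<in> C"
      have "\<exists>d. (\<forall>k. d k \<in> {0, 1 :: real}) \<and> (\<lambda>k. d k / 2 ^ Suc k) sums ((x \<bullet> b / R + 1) / 2)"
        if "b \<in> Basis" for b
      proof -
        have "\<bar>x \<bullet> b\<bar> \<le> R" using Basis_le_norm[OF that, of x] R(2)[OF x] by linarith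
        then have "0 \<le> (x \<bullet> b / R + 1) / 2" "(x \<bullet> b / R + 1) / 2 \<le> 1"
          using R(1) by (auto simp: field_simps abs_le_iff)
        then show ?thesis using binary_expansion[of "(x \<bullet> b / R + 1) / 2"] by metis
      qed
      then obtain d where d: "\<And>b k. b \<in> Basis \<Longrightarrow> d b k \<in> {0, 1 :: real}"
        "\<And>b. b \<in> Basis \<Longrightarrow> (\<lambda>k. d b k / 2 ^ Suc k) sums ((x \<bullet> b / R + 1) / 2)" by metis
      \<comment> \<open>Position \<open>n\<close> receives binary digit \<open>n div DIM('a)\<close>
        of coordinate number \<open>n mod DIM('a)\<close>, the inverse of the reading in
        \<open>w\<close>.\<close>
      define D where "D n = d (inv_into Basis idx (n mod DIM('a))) (n div DIM('a))" for n
      have D01: "D n \<in> {0, 1}" for n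
      proof -
        have "n mod DIM('a) \<in> idx ` Basis" using idx by (auto simp: bij_betw_def)
        then show ?thesis unfolding D_def by (intro d(1) inv_into_into)
      qed
      have D: "D (DIM('a) * k + idx b) = d b k" if "b \<in> Basis" for b k
      proof -
        have "idx b < DIM('a)" using idx that by (auto simp: bij_betw_def)
        then show ?thesis using idx that by (simp add: D_def bij_betw_def)
      qed
      let ?t = "cantor_point D"
      have wb: "w b ?t = (x \<bullet> b / R + 1) / 2" if "b \<in> Basis" for b
        using sums_unique[OF d(2)[OF that]]
        by (simp add: w_def schoenberg_wave_cantor_point[OF D01] D[OF that])
      then have "R * (2 * w b ?t - 1) = x \<bullet> b" if "b \<in> Basis" for b
        unfolding wb[OF that] using R(1) by (simp add: field_simps)
      then have "q ?t = (\<Sum>b\<in>Basis. (x \<bullet> b) *\<^sub>R b)"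
        unfolding q_def by (intro sum.cong) auto
      then have "q ?t = x" by (simp add: euclidean_representation)
      then show "x \<in> q ` {0..1}" using cantor_series(2,3)[OF D01] by force
    qed
  qed
qed


text \<open>Closed sets form an intersection-stable generator, and the indicator of a nonempty
  closed \<open>A\<close> is the pointwise limit of \<open>max 0 (1 - k * infdist x A)\<close>. The
  empty set is treated apart because \<open>infdist x {}\<close> is 0 by convention.\<close>

lemma measure_eqI_continuous:
  fixes M N :: "'a::metric_space measure"
  assumes "prob_space M" "prob_space N" and M: "sets M = sets borel" and N: "sets N = sets borel"
    and eq: "\<And>f. continuous_on UNIV f \<Longrightarrow> (\<And>x. 0 \<le> f x \<and> f x \<le> (1::real)) \<Longrightarrow> (\<integral>x. f x \<partial>M) = (\<integral>x. f x \<partial>N)"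
  shows "M = N"
proof -
  interpret M: prob_space M by fact
  interpret N: prob_space N by fact
  note [measurable_cong] = M N
  have cl: "emeasure M A = emeasure N A" if A: "closed A" for A
  proof (cases "A = {}")
    case False
    define f where "f k x = max 0 (1 - real k * infdist x A)" for k x
    have Am [measurable]: "A \<in> sets borel" using A by simp
    have fm [measurable]: "f k \<in> borel_measurable borel" for k
      unfolding f_def by (intro borel_measurable_continuous_onI continuous_intros)
    have f: "0 \<le> f k x" "f k x \<le> 1" for k x
      using infdist_nonneg[of x A] by (auto simp: f_def)
    have lim: "(\<lambda>k. f k x) \<longlonglongrightarrow> indicator A x" for x
    proof (cases "x \<in> A")
      case True
      then show ?thesis by (simp add: f_def)
    next
      case nin: False
      then have "infdist x A > 0" using A False by (metis in_closed_iff_infdist_zero infdist_nonneg less_eq_real_def)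
      then obtain K where K: "1 / infdist x A < real K" using reals_Archimedean2 by blast
      have "f k x = 0" if "k \<ge> K" for k
      proof -
        have "1 / infdist x A < real k" using K that by linarith
        then show ?thesis using \<open>infdist x A > 0\<close> by (simp add: f_def field_simps)
      qed
      then have "(\<lambda>k. f k x) \<longlonglongrightarrow> 0" by (intro tendsto_eventually eventually_sequentiallyI)
      then show ?thesis using nin by simp
    qed
    have m: "(\<lambda>k. \<integral>x. f k x \<partial>L) \<longlonglongrightarrow> measure L A" if "prob_space L" "sets L = sets borel" for L
    proof -
      interpret L: prob_space L by fact
      note [measurable_cong] = that(2)
      have "(\<lambda>k. \<integral>x. f k x \<partial>L) \<longlonglongrightarrow> (\<integral>x. indicator A x \<partial>L)"
        by (rule integral_dominated_convergence[where w = "\<lambda>_. 1"])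
           (use lim f in \<open>auto simp: measurable_cong_sets[OF that(2) refl]\<close>)
      then show ?thesis using sets_eq_imp_space_eq[OF that(2)] by simp
    qed
    have "(\<integral>x. f k x \<partial>M) = (\<integral>x. f k x \<partial>N)" for k
      by (rule eq) (use f in \<open>auto simp: f_def intro!: continuous_intros\<close>)
    then have "measure M A = measure N A"
      using m[OF \<open>prob_space M\<close> M] m[OF \<open>prob_space N\<close> N] LIMSEQ_unique by simp
    then show ?thesis by (simp add: M.emeasure_eq_measure N.emeasure_eq_measure)
  qed simp
  show ?thesis
  proof (rule measure_eqI_generator_eq[where E = "Collect closed" and A = "\<lambda>_. UNIV" and \<Omega> = UNIV])
    show "Int_stable (Collect (closed :: 'a set \<Rightarrow> bool))" by (auto simp: Int_stable_def)
    show "sets M = sigma_sets UNIV (Collect closed)" "sets N = sigma_sets UNIV (Collect closed)"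
      unfolding M N borel_eq_closed by simp_all
    show "emeasure M UNIV \<noteq> \<infinity>" by (simp add: M.emeasure_eq_measure)
  qed (use cl in auto)
qed

text \<open>Lifting the points along a space-filling curve reduces weak compactness to Helly's theorem on the line.\<close>

lemma empirical_measures_subsequence:
  fixes x :: "nat \<Rightarrow> nat \<Rightarrow> 'a::euclidean_space"
  assumes C: "compact C" and x: "\<And>n i. x n i \<in> C"
  obtains \<mu> r where "strict_mono (r :: nat \<Rightarrow> nat)" "sets \<mu> = sets borel" "prob_space \<mu>" "AE y in \<mu>. y \<in> C"
    "\<And>f. continuous_on UNIV f \<Longrightarrow>
      (\<lambda>k. (\<Sum>i<Suc (r k). f (x (r k) i)) / real (Suc (r k))) \<longlonglongrightarrow> (\<integral>y. f y \<partial>\<mu>)"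
proof -
  obtain q :: "real \<Rightarrow> 'a" where q: "continuous_on UNIV q" "bounded (range q)" "C \<subseteq> q ` {0..1}"
    using space_filling_curve[OF compact_imp_bounded[OF C]] .
  have "\<exists>t. t \<in> {0..1} \<and> q t = x n i" for n i using q(3) x[of n i] by force
  then obtain e where e: "\<And>n i. e n i \<in> {0..1}" "\<And>n i. q (e n i) = x n i" by metis
  \<comment> \<open>Uniform weights on \<open>Suc n\<close> indices; the shift keeps the index set
    nonempty at \<open>n = 0\<close>.\<close>
  define p where "p n = measure_pmf (pmf_of_set {..<Suc n})" for n
  define \<nu> where "\<nu> n = distr (p n) borel (e n)" for n
  have em [measurable]: "e n \<in> measurable (p n) borel" for n by (simp add: p_def)
  have qm [measurable]: "q \<in> borel_measurable borel" using q(1) by (rule borel_measurable_continuous_onI)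
  have ps: "prob_space (p n)" for n by (simp add: p_def measure_pmf.prob_space_axioms)
  have rd: "real_distribution (\<nu> n)" for n
    unfolding \<nu>_def by (intro real_distribution.intro prob_space.prob_space_distr[OF ps])
       (auto simp: real_distribution_axioms_def)
  have "measure (\<nu> n) {-1<..1} = 1" for n
  proof -
    have "e n -` {-1<..1} \<inter> space (p n) = space (p n)" using e(1) by (force simp: p_def)
    then show ?thesis unfolding \<nu>_def using prob_space.prob_space[OF ps]
      by (subst measure_distr) auto
  qed
  then have "tight \<nu>" unfolding tight_def using rd by (intro conjI allI impI exI[of _ "-1"] exI[of _ 1]) auto
  then obtain r M where r: "strict_mono (r :: nat \<Rightarrow> nat)" "real_distribution M" "weak_conv_m (\<nu> \<circ> r) M"
    using tight_imp_convergent_subsubsequence[of \<nu> id] by (auto simp: strict_mono_def)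
  interpret M: real_distribution M by fact
  define \<mu> where "\<mu> = distr M borel q"
  have qM [measurable]: "q \<in> measurable M borel" by simp
  have \<mu>: "prob_space \<mu>" "sets \<mu> = sets borel" unfolding \<mu>_def by (auto intro: M.prob_space_distr)
  have conv: "(\<lambda>k. (\<Sum>i<Suc (r k). f (x (r k) i)) / real (Suc (r k))) \<longlonglongrightarrow> (\<integral>y. f y \<partial>\<mu>)"
    if f: "continuous_on UNIV f" for f :: "'a \<Rightarrow> real"
  proof -
    have fm [measurable]: "f \<in> borel_measurable borel" using f by (rule borel_measurable_continuous_onI)
    have cf: "continuous_on UNIV (\<lambda>t. f (q t))"
      by (rule continuous_on_compose2[OF f q(1)]) simp
    \<comment> \<open>Weak convergence on the line is tested with bounded continuous functions on
      all of it, which is why \<open>q\<close> has bounded range.\<close>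
    have "bounded (f ` closure (range q))"
      by (intro compact_imp_bounded compact_continuous_image continuous_on_subset[OF f])
         (use q(2) in \<open>auto simp: compact_closure\<close>)
    then obtain B where B: "\<And>t. norm (f (q t)) \<le> B"
      unfolding bounded_iff by (meson closure_subset imageI rangeI subsetD)
    have sub: "real_distribution ((\<nu> \<circ> r) n)" for n by (simp add: rd)
    have "(\<lambda>k. \<integral>t. f (q t) \<partial>(\<nu> \<circ> r) k) \<longlonglongrightarrow> (\<integral>t. f (q t) \<partial>M)"
      by (rule weak_conv_imp_integral_bdd_continuous_conv[OF sub r(2,3) _ B])
         (use cf in \<open>auto simp: continuous_on_eq_continuous_at\<close>)
    moreover have "(\<integral>t. f (q t) \<partial>\<nu> n) = (\<Sum>i<Suc n. f (x n i)) / real (Suc n)" for n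
    proof -
      have "(\<integral>t. f (q t) \<partial>\<nu> n) = (\<integral>i. f (x n i) \<partial>p n)"
        unfolding \<nu>_def by (subst integral_distr) (auto simp: e)
      then show ?thesis unfolding p_def by (subst (asm) integral_pmf_of_set) auto
    qed
    moreover have "(\<integral>y. f y \<partial>\<mu>) = (\<integral>t. f (q t) \<partial>M)"
      unfolding \<mu>_def by (rule integral_distr) auto
    ultimately show ?thesis by simp
  qed
  \<comment> \<open>Test with the distance to \<open>C\<close>: its averages are 0, so this
    nonnegative function has integral 0.\<close>
  have "AE y in \<mu>. y \<in> C"
  proof -
    interpret mu: prob_space \<mu> by fact
    have ne: "C \<noteq> {}" using x by auto
    have "(\<lambda>k. (\<Sum>i<Suc (r k). infdist (x (r k) i) C) / real (Suc (r k))) \<longlonglongrightarrow> (\<integral>y. infdist y C \<partial>\<mu>)"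
      by (rule conv) (intro continuous_intros)
    moreover have "infdist (x n i) C = 0" for n i using x by simp
    ultimately have 0: "(\<integral>y. infdist y C \<partial>\<mu>) = 0" by (simp add: LIMSEQ_const_iff)
    have im [measurable]: "(\<lambda>y. infdist y C) \<in> borel_measurable borel"
      by (intro borel_measurable_continuous_onI continuous_intros)
    have "bounded ((\<lambda>y. infdist y C) ` closure (range q))"
      by (intro compact_imp_bounded compact_continuous_image continuous_intros)
         (use q(2) in \<open>auto simp: compact_closure\<close>)
    then obtain B where B: "\<And>t. norm (infdist (q t) C) \<le> B"
      unfolding bounded_iff by (meson closure_subset imageI rangeI subsetD)
    have "integrable M (\<lambda>t. infdist (q t) C)"
      by (rule M.integrable_const_bound[where B = B]) (use B in auto)
    then have "integrable \<mu> (\<lambda>y. infdist y C)"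
      unfolding \<mu>_def by (subst integrable_distr_eq) auto
    then have "AE y in \<mu>. infdist y C = 0"
      using 0 by (subst (asm) integral_nonneg_eq_0_iff_AE) (auto simp: infdist_nonneg)
    then show ?thesis
      by eventually_elim (use compact_imp_closed[OF C] ne in_closed_iff_infdist_zero in blast)
  qed
  then show thesis using that[OF r(1) \<mu>(2,1) _ conv] by blast
qed

text \<open>A Krylov-Bogolyubov argument along orbit segments whose starting point varies with their
  length. Continuity is only assumed on \<open>C\<close>, because \<open>tangent_map\<close>
  normalises vectors and breaks down at the zero vector; Tietze's theorem supplies global test
  functions, and the limit measure does not see their values off \<open>C\<close>.\<close>

theorem invariant_measure_of_birkhoff_averages:
  fixes T :: "'a::euclidean_space \<Rightarrow> 'a" and b :: "'a \<Rightarrow> real"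
  assumes C: "compact C" and TC: "T \<in> C \<rightarrow> C" and cT: "continuous_on C T"
    and Tm: "T \<in> borel_measurable borel" and cb: "continuous_on C b" and z: "\<And>n. z n \<in> C"
    and l: "(\<lambda>n. birkhoff_sum T b n (z n) / n) \<longlonglongrightarrow> l"
  obtains \<mu> L B where "sets \<mu> = sets borel" "prob_space \<mu>" "distr \<mu> borel T = \<mu>" "AE x in \<mu>. x \<in> C"
    "L \<in> borel_measurable borel" "\<And>x. \<bar>L x\<bar> \<le> (B::real)"
    "AE x in \<mu>. (\<lambda>n. birkhoff_sum T b n x / n) \<longlonglongrightarrow> L x" "(\<integral>x. L x \<partial>\<mu>) = l"
proof -
  have orb: "(T ^^ i) x \<in> C" if "x \<in> C" for x i
    using that TC by (induction i) auto
  obtain r \<mu> where r: "strict_mono (r :: nat \<Rightarrow> nat)" and \<mu>: "sets \<mu> = sets borel" "prob_space \<mu>"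
    and AEC: "AE y in \<mu>. y \<in> C"
    and conv: "\<And>f. continuous_on UNIV f \<Longrightarrow>
      (\<lambda>k. (\<Sum>i<Suc (r k). f ((T ^^ i) (z (Suc (r k))))) / real (Suc (r k))) \<longlonglongrightarrow> (\<integral>y. f y \<partial>\<mu>)"
    \<comment> \<open>Row \<open>n\<close> of the array has \<open>Suc n\<close> entries, hence the
      orbit segment starting at \<open>z (Suc n)\<close>.\<close>
    by (rule empirical_measures_subsequence[where x = "\<lambda>n i. (T ^^ i) (z (Suc n))", OF C orb[OF z]]) blast
  interpret prob_space \<mu> by fact
  note [measurable_cong] = \<mu>(1)
  note Tm [measurable]
  have \<mu>T: "prob_space (distr \<mu> borel T)" by (rule prob_space_distr) simp
  have "\<exists>g B. continuous_on UNIV g \<and> (\<forall>x\<in>C. g x = f x) \<and> (\<forall>x. \<bar>g x\<bar> \<le> B)"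
    if f: "continuous_on C f" for f :: "'a \<Rightarrow> real"
  proof -
    obtain B where "\<And>x. x \<in> C \<Longrightarrow> norm (f x) \<le> B"
      using compact_imp_bounded[OF compact_continuous_image[OF f C]] by (auto simp: bounded_iff)
    then have "\<And>x. x \<in> C \<Longrightarrow> norm (f x) \<le> max 0 B" by fastforce
    then obtain g where "continuous_on UNIV g" "\<And>x. x \<in> C \<Longrightarrow> g x = f x" "\<And>x. norm (g x) \<le> max 0 B"
      using Tietze[OF f, of UNIV "max 0 B"] compact_imp_closed[OF C] by auto
    then show ?thesis by auto
  qed note ext = this
  have inv: "distr \<mu> borel T = \<mu>"
  proof (rule measure_eqI_continuous[OF \<mu>T \<mu>(2) _ \<mu>(1)])
    fix f :: "'a \<Rightarrow> real" assume f: "continuous_on UNIV f" and f01: "\<And>x. 0 \<le> f x \<and> f x \<le> 1"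
    have fm [measurable]: "f \<in> borel_measurable borel" using f by (rule borel_measurable_continuous_onI)
    have "continuous_on C (\<lambda>x. f (T x))"
      by (rule continuous_on_compose2[OF f cT]) simp
    from ext[OF this] obtain g where g: "continuous_on UNIV g" "\<And>x. x \<in> C \<Longrightarrow> g x = f (T x)" by blast
    have gm [measurable]: "g \<in> borel_measurable borel" using g(1) by (rule borel_measurable_continuous_onI)
    have "(\<lambda>k. (\<Sum>i<Suc (r k). g ((T ^^ i) (z (Suc (r k))))) / real (Suc (r k))
             - (\<Sum>i<Suc (r k). f ((T ^^ i) (z (Suc (r k))))) / real (Suc (r k))) \<longlonglongrightarrow> 0"
    proof (rule Lim_null_comparison)
      have "(\<lambda>n. 1 / real (Suc n)) \<longlonglongrightarrow> 0" by real_asymp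
      then show "(\<lambda>k. 1 / real (Suc (r k))) \<longlonglongrightarrow> 0" using LIMSEQ_subseq_LIMSEQ[OF _ r] by (auto simp: comp_def)
      \<comment> \<open>On \<open>C\<close> the function \<open>g\<close> is \<open>f\<close> after
        \<open>T\<close>, so only the two ends of the segment survive; they differ by at most 1 as
        \<open>f\<close> takes values in [0, 1].\<close>
      have tele: "(\<Sum>i<n. g ((T ^^ i) x)) - (\<Sum>i<n. f ((T ^^ i) x)) = f ((T ^^ n) x) - f x" if "x \<in> C" for n x
        by (induction n) (use g(2) orb that in auto)
      have "\<bar>f u - f v\<bar> \<le> 1" for u v using f01[of u] f01[of v] by linarith
      then show "\<forall>\<^sub>F k in sequentially. norm ((\<Sum>i<Suc (r k). g ((T ^^ i) (z (Suc (r k))))) / real (Suc (r k))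
             - (\<Sum>i<Suc (r k). f ((T ^^ i) (z (Suc (r k))))) / real (Suc (r k))) \<le> 1 / real (Suc (r k))"
        unfolding diff_divide_distrib[symmetric] tele[OF z]
        by (auto simp del: of_nat_Suc intro!: always_eventually divide_right_mono)
    qed
    moreover note tendsto_diff[OF conv[OF g(1)] conv[OF f]]
    ultimately have "(\<integral>y. g y \<partial>\<mu>) = (\<integral>y. f y \<partial>\<mu>)" using LIMSEQ_unique by fastforce
    moreover have "(\<integral>y. g y \<partial>\<mu>) = (\<integral>y. f (T y) \<partial>\<mu>)"
      by (rule integral_cong_AE) (use AEC g(2) in auto)
    ultimately show "(\<integral>x. f x \<partial>distr \<mu> borel T) = (\<integral>x. f x \<partial>\<mu>)"
      by (subst integral_distr) auto
  qed simp
  obtain h B where h: "continuous_on UNIV h" "\<And>x. x \<in> C \<Longrightarrow> h x = b x" "\<And>x. \<bar>h x\<bar> \<le> B"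
    using ext[OF cb] by blast
  have hm [measurable]: "h \<in> borel_measurable borel" using h(1) by (rule borel_measurable_continuous_onI)
  have bh: "birkhoff_sum T b n x = birkhoff_sum T h n x" if "x \<in> C" for n x
    unfolding birkhoff_sum_def using h(2) orb[OF that] by auto
  have "(\<lambda>k. birkhoff_sum T b (Suc (r k)) (z (Suc (r k))) / real (Suc (r k))) \<longlonglongrightarrow> l"
    using LIMSEQ_subseq_LIMSEQ[OF LIMSEQ_Suc[OF l] r] by (simp add: comp_def)
  moreover have "(\<lambda>k. birkhoff_sum T b (Suc (r k)) (z (Suc (r k))) / real (Suc (r k))) \<longlonglongrightarrow> (\<integral>y. h y \<partial>\<mu>)"
    using conv[OF h(1)] unfolding bh[OF z] unfolding birkhoff_sum_def .
  ultimately have hl: "(\<integral>y. h y \<partial>\<mu>) = l" using LIMSEQ_unique by blast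
  have T\<mu>: "T \<in> measurable \<mu> \<mu>" and h\<mu>: "h \<in> borel_measurable \<mu>"
    using Tm by (simp_all add: measurable_cong_sets[OF \<mu>(1) \<mu>(1)])
  have invT: "distr \<mu> \<mu> T = \<mu>" using inv distr_cong[where M = \<mu> and K = \<mu> and N = \<mu> and L = borel and f = T and g = T] \<mu>(1) by simp
  obtain L where L: "L \<in> borel_measurable \<mu>" "\<And>x. \<bar>L x\<bar> \<le> B"
    "AE x in \<mu>. (\<lambda>n. birkhoff_sum T h n x / n) \<longlonglongrightarrow> L x" "(\<integral>x. L x \<partial>\<mu>) = (\<integral>x. h x \<partial>\<mu>)"
    by (rule birkhoff_ergodic_bounded[OF \<mu>(2) T\<mu> invT h\<mu> h(3)]) blast
  have Lb: "AE x in \<mu>. (\<lambda>n. birkhoff_sum T b n x / n) \<longlonglongrightarrow> L x"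
    using L(3) AEC
  proof eventually_elim
    case (elim x)
    then show ?case by (simp only: bh)
  qed
  have Lm: "L \<in> borel_measurable borel" using L(1) by simp
  have "(\<integral>x. L x \<partial>\<mu>) = l" using L(4) hl by (rule trans)
  then show thesis by (rule that[OF \<mu> inv AEC Lm L(2) Lb])
qed

section \<open>Chord angles of an arc\<close>

text \<open>The values lie in the discrete set of multiples of \<open>2 * pi\<close>. Applied to the
  difference of two lifts of one curve, this gives their uniqueness up to a constant.\<close>

lemma continuous_cis_eq_1_imp_constant:
  fixes f :: "'a::topological_space \<Rightarrow> real"
  assumes "connected S" "continuous_on S f" "\<And>x. x \<in> S \<Longrightarrow> cis (f x) = 1" "x \<in> S" "y \<in> S"
  shows "f x = f y"
proof -
  have "f constant_on S"
  proof (rule continuous_discrete_range_constant[OF assms(1,2)])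
    fix x assume x: "x \<in> S"
    have "2 * pi \<le> norm (f y - f x)" if y: "y \<in> S" "f y \<noteq> f x" for y
    proof -
      have "cis (f y - f x) = 1" using cis_divide[of "f y" "f x"] assms(3)[OF x] assms(3)[OF y(1)] by simp
      then have "cos (f y - f x) = 1" by (simp add: complex_eq_iff)
      then obtain n :: int where n: "f y - f x = of_int n * 2 * pi" using cos_one_2pi_int by blast
      then have "n \<noteq> 0" using y by auto
      then have "1 \<le> \<bar>real_of_int n\<bar>" by linarith
      then show ?thesis unfolding n by (simp add: abs_mult)
    qed
    then show "\<exists>e>0. \<forall>y. y \<in> S \<and> f y \<noteq> f x \<longrightarrow> e \<le> norm (f y - f x)" by (intro exI[of _ "2 * pi"]) auto
  qed
  then show ?thesis using assms(4,5) by (auto simp: constant_on_def)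
qed

lemma connected_avoids_value:
  fixes c :: real
  assumes "connected S" "c \<notin> S"
  shows "(\<forall>y\<in>S. y > c) \<or> (\<forall>y\<in>S. y < c)"
proof (rule ccontr)
  assume "\<not> ?thesis"
  then obtain y z where "y \<in> S" "y \<le> c" "z \<in> S" "c \<le> z" by (auto simp: not_less)
  from connectedD_interval[OF assms(1) this(1,3,2,4)] show False using assms(2) by simp
qed

text \<open>The lift \<open>a\<close> of the directions of the chords of an arc, on the triangle of parameter pairs
  \<open>p \<le> m \<le> m' \<le> q\<close>; the diagonal carries the tangent directions, and \<open>R\<close> is the length of the
  difference quotient.\<close>

definition chord_angles :: "(real \<Rightarrow> real \<Rightarrow> real) \<Rightarrow> (real \<Rightarrow> real \<Rightarrow> real) \<Rightarrow> real \<Rightarrow> real \<Rightarrow> bool" where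
  "chord_angles R a p q \<longleftrightarrow>
     continuous_on {(m, m'). p \<le> m \<and> m \<le> m' \<and> m' \<le> q} (\<lambda>(m, m'). a m m') \<and>
     (\<forall>m m'. p \<le> m \<longrightarrow> m \<le> m' \<longrightarrow> m' \<le> q \<longrightarrow> R m m' > 0) \<and>
     (\<forall>m m' m''. p \<le> m \<longrightarrow> m \<le> m' \<longrightarrow> m' \<le> m'' \<longrightarrow> m'' \<le> q \<longrightarrow>
        ((m'' - m) * R m m'') *\<^sub>R cis (a m m'') =
        ((m' - m) * R m m') *\<^sub>R cis (a m m') + ((m'' - m') * R m' m'') *\<^sub>R cis (a m' m''))"

lemma chord_anglesD:
  assumes "chord_angles R a p q"
  shows "continuous_on {(m, m'). p \<le> m \<and> m \<le> m' \<and> m' \<le> q} (\<lambda>(m, m'). a m m')"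
    and "p \<le> m \<Longrightarrow> m \<le> m' \<Longrightarrow> m' \<le> q \<Longrightarrow> R m m' > 0"
    and "p \<le> m \<Longrightarrow> m \<le> m' \<Longrightarrow> m' \<le> m'' \<Longrightarrow> m'' \<le> q \<Longrightarrow>
        ((m'' - m) * R m m'') *\<^sub>R cis (a m m'') =
        ((m' - m) * R m m') *\<^sub>R cis (a m m') + ((m'' - m') * R m' m'') *\<^sub>R cis (a m' m'')"
  using assms unfolding chord_angles_def by blast+

lemma chord_angles_subset:
  assumes "chord_angles R a p q" "p \<le> p'" "q' \<le> q"
  shows "chord_angles R a p' q'"
  unfolding chord_angles_def
proof (intro conjI allI impI)
  show "continuous_on {(m, m'). p' \<le> m \<and> m \<le> m' \<and> m' \<le> q'} (\<lambda>(m, m'). a m m')"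
    by (rule continuous_on_subset[OF chord_anglesD(1)[OF assms(1)]]) (use assms in auto)
qed (rule chord_anglesD[OF assms(1)]; use assms in linarith)+

text \<open>Reflecting the arc conjugates its chords. This reduces the case in which all shorter
  chords have smaller angles to the one in which they have larger angles.\<close>

lemma chord_angles_uminus:
  assumes "chord_angles R a p q"
  shows "chord_angles R (\<lambda>m m'. - a m m') p q"
  unfolding chord_angles_def
proof (intro conjI allI impI)
  show "continuous_on {(m, m'). p \<le> m \<and> m \<le> m' \<and> m' \<le> q} (\<lambda>(m, m'). - a m m')"
    using continuous_on_minus[OF chord_anglesD(1)[OF assms]] by (simp add: case_prod_unfold)
  show "((m'' - m) * R m m'') *\<^sub>R cis (- a m m'') =
          ((m' - m) * R m m') *\<^sub>R cis (- a m m') + ((m'' - m') * R m' m'') *\<^sub>R cis (- a m' m'')"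
    if "p \<le> m" "m \<le> m'" "m' \<le> m''" "m'' \<le> q" for m m' m''
    using arg_cong[OF chord_anglesD(3)[OF assms that], of cnj] by (simp add: cis_cnj)
qed (rule chord_anglesD(2)[OF assms])

text \<open>The point \<open>p\<close> sees \<open>m\<close> and \<open>m'\<close> at the angle \<open>E\<close>, and \<open>D\<close> is the turn of the path from \<open>p\<close>
  through \<open>m\<close> to \<open>m'\<close>. The pairs \<open>(D, E)\<close> arising from triangles fill triangular tiles that meet only
  at vertices, and the origin cuts the two tiles containing it apart. The map \<open>P\<close> wraps these two tiles
  around the circle and sends all others to \<open>-1\<close>; its lift changes sign along the edge \<open>m' = q\<close>, so
  this edge meets the origin, that is, \<open>E = D = 0\<close> there.\<close>

lemma chord_angles_not_minimal:
  assumes a: "chord_angles R a p q" and "p < q"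
    and gt: "\<And>m m'. p \<le> m \<Longrightarrow> m \<le> m' \<Longrightarrow> m' \<le> q \<Longrightarrow> (m, m') \<noteq> (p, q) \<Longrightarrow> a m m' > a p q"
  shows False
proof -
  let ?T = "{(m, m'). p \<le> m \<and> m \<le> m' \<and> m' \<le> q}"
  note c = chord_anglesD(1)[OF a] and R = chord_anglesD(2)[OF a] and tri = chord_anglesD(3)[OF a]
  define D where "D = (\<lambda>(m, m'). a m m' - a p m)"
  define E where "E = (\<lambda>(m, m'). a p m' - a p m)"
  have ca: "continuous_on S (\<lambda>x. a (f x) (g x))"
    if "continuous_on S f" "continuous_on S g" "\<And>x. x \<in> S \<Longrightarrow> p \<le> f x \<and> f x \<le> g x \<and> g x \<le> q"
    for S :: "'b::topological_space set" and f g
    using continuous_on_compose2[OF c continuous_on_Pair[OF that(1,2)]] that(3) by auto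
  have cD: "continuous_on ?T D" and cE: "continuous_on ?T E"
    unfolding D_def E_def case_prod_unfold using \<open>p < q\<close>
    by (auto intro!: continuous_intros ca)
  \<comment> \<open>The triangle with vertices at \<open>p\<close>, \<open>m\<close>,
    \<open>m'\<close>, turned by \<open>- a p m\<close>: \<open>u\<close>, \<open>v\<close>,
    \<open>w\<close> are its side lengths, and the direction \<open>E\<close> lies in the cone
    spanned by the directions 0 and \<open>D\<close>. This cone condition is what confines
    \<open>(D, E)\<close> to the tiles.\<close>
  have key: "\<exists>u v w. u *\<^sub>R cis (E x) = of_real v + w *\<^sub>R cis (D x) \<and> u \<ge> 0 \<and> v \<ge> 0 \<and> w \<ge> 0
      \<and> (x = (p, p) \<or> u > 0 \<and> v + w > 0)" if xT: "x \<in> ?T" for x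
  proof -
    obtain m m' where x: "x = (m, m')" "p \<le> m" "m \<le> m'" "m' \<le> q" using xT by (cases x) auto
    let ?u = "(m' - p) * R p m'" and ?v = "(m - p) * R p m" and ?w = "(m' - m) * R m m'"
    have Rp: "R p m' > 0" "R p m > 0" "R m m' > 0" using x by (auto intro: R)
    have "?u *\<^sub>R cis (a p m') * cis (- a p m) = (?v *\<^sub>R cis (a p m) + ?w *\<^sub>R cis (a m m')) * cis (- a p m)"
      using tri[of p m m'] x by simp
    then have "?u *\<^sub>R cis (a p m' + - a p m) = ?v *\<^sub>R cis (a p m + - a p m) + ?w *\<^sub>R cis (a m m' + - a p m)"
      by (simp only: distrib_right mult_scaleR_left cis_mult)
    then have "?u *\<^sub>R cis (E x) = of_real ?v + ?w *\<^sub>R cis (D x)"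
      unfolding x D_def E_def prod.case add_uminus_conv_diff diff_self cis_zero of_real_def .
    moreover have "?u \<ge> 0" "?v \<ge> 0" "?w \<ge> 0" using Rp x by auto
    moreover have "?u > 0 \<and> ?v + ?w > 0" if "x \<noteq> (p, p)"
    proof -
      have "m' > p" using that x by auto
      moreover have "?v + ?w > 0"
      proof (cases "m > p")
        case True
        then show ?thesis using Rp \<open>?w \<ge> 0\<close> by (simp add: add_pos_nonneg)
      next
        case False
        then show ?thesis using Rp \<open>?v \<ge> 0\<close> \<open>m' > p\<close> x by (simp add: add_nonneg_pos)
      qed
      ultimately show ?thesis using Rp by simp
    qed
    ultimately show ?thesis by blast
  qed
  have DEpp: "D (p, p) = 0" "E (p, p) = 0" by (simp_all add: D_def E_def)
  have cis_pi': "cis t = -1" if "\<bar>t\<bar> = pi" for t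
  proof -
    from that have "t = pi \<or> t = - pi" by (auto simp: abs_if split: if_splits)
    then show ?thesis by (auto simp: complex_eq_iff)
  qed
  \<comment> \<open>If \<open>E\<close> is \<open>pi\<close> or \<open>- pi\<close>, the cone
    condition makes \<open>D\<close> point backwards too. So \<open>cis (D x)\<close> is -1 wherever
    the square of side \<open>2 * pi\<close> is left, and the two branches of \<open>P\<close> fit
    together.\<close>
  have bdry: "\<bar>D x\<bar> = pi" if x: "x \<in> ?T" "\<bar>D x\<bar> \<le> pi" "\<bar>E x\<bar> \<le> pi" "\<bar>D x\<bar> \<ge> pi \<or> \<bar>E x\<bar> \<ge> pi" for x
  proof (cases "\<bar>D x\<bar> = pi")
    case False
    then have E: "\<bar>E x\<bar> = pi" using x by linarith
    then have ne: "x \<noteq> (p, p)" using DEpp by auto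
    obtain u v w where uvw: "u *\<^sub>R cis (E x) = of_real v + w *\<^sub>R cis (D x)" "u > 0" "v \<ge> 0" "w \<ge> 0"
      using key[OF x(1)] ne by blast
    have cE: "cis (E x) = -1" using E by (rule cis_pi')
    have re: "- u = v + w * cos (D x)" and im: "0 = w * sin (D x)"
      using uvw(1) unfolding cE by (auto simp: complex_eq_iff)
    have wc: "w * cos (D x) < 0" using re uvw by linarith
    then have "w > 0" "cos (D x) < 0" using uvw(4) by (auto simp: mult_less_0_iff)
    then have "sin (D x) = 0" using im by simp
    then obtain i :: int where i: "D x = of_int i * pi" using sin_zero_iff_int2 by blast
    have "\<bar>of_int i\<bar> * pi < 1 * pi" using x(2) False unfolding i by (simp add: abs_mult)
    then have "\<bar>of_int i\<bar> < (1::real)" by (rule mult_right_less_imp_less) simp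
    then have "i = 0" by linarith
    then have "cos (D x) = 1" using i by simp
    then show ?thesis using \<open>cos (D x) < 0\<close> by simp
  qed
  \<comment> \<open>If \<open>D\<close> is 0, the cone shrinks to a ray and forces \<open>E\<close>
    to be 0 as well.\<close>
  have zero: "D x = 0 \<and> E x = 0" if x: "x \<in> ?T" "\<bar>D x\<bar> \<le> pi" "\<bar>E x\<bar> \<le> pi" "cis (D x) = 1" for x
  proof (cases "x = (p, p)")
    case False
    obtain u v w where uvw: "u *\<^sub>R cis (E x) = of_real v + w *\<^sub>R cis (D x)" "u > 0" "v + w > 0"
      using key[OF x(1)] False by blast
    have eq0: "t = 0" if t: "cos t = 1" "\<bar>t\<bar> \<le> pi" for t
    proof -
      obtain n :: int where n: "t = of_int n * 2 * pi" using t(1) cos_one_2pi_int by blast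
      then have "\<bar>real_of_int n\<bar> * 2 \<le> 1" using t(2) by (simp add: abs_mult)
      then have "n = 0" by linarith
      then show ?thesis using n by simp
    qed
    have "cos (D x) = 1" using x(4) by (simp add: complex_eq_iff)
    then have D0: "D x = 0" using eq0 x(2) by blast
    have ucos: "u * cos (E x) = v + w" and "u * sin (E x) = 0"
      using uvw(1) unfolding D0 by (simp_all add: complex_eq_iff)
    then have "sin (E x) = 0" using uvw(2) by simp
    then have "(cos (E x))\<^sup>2 = 1" by (simp add: cos_squared_eq)
    moreover have "cos (E x) > 0"
      using uvw(2,3) unfolding ucos[symmetric] by (metis zero_less_mult_pos)
    ultimately have "cos (E x) = 1" by (simp add: power2_eq_1_iff)
    then show ?thesis using D0 eq0 x(3) by blast
  qed (use DEpp in auto)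
  have clT: "closed ?T"
  proof -
    have "?T = {x. p \<le> fst x} \<inter> {x. fst x \<le> snd x} \<inter> {x. snd x \<le> q}" by auto
    then show ?thesis by (auto intro!: closed_Int closed_Collect_le continuous_intros)
  qed
  have cvT: "convex ?T"
    unfolding convex_alt
  proof clarsimp
    fix m m' n n' t :: real
    assume *: "p \<le> m" "m \<le> m'" "m' \<le> q" "p \<le> n" "n \<le> n'" "n' \<le> q" "0 \<le> t" "t \<le> 1"
    have "(1 - t) * p \<le> (1 - t) * m" "t * p \<le> t * n" "(1 - t) * m \<le> (1 - t) * m'" "t * n \<le> t * n'"
      "(1 - t) * m' \<le> (1 - t) * q" "t * n' \<le> t * q"
      using * by (auto intro!: mult_left_mono)
    then show "p \<le> (1 - t) * m + t * n \<and> (1 - t) * m + t * n \<le> (1 - t) * m' + t * n' \<and> (1 - t) * m' + t * n' \<le> q"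
      by (simp add: algebra_simps)
  qed
  define P where "P x = (if \<bar>D x\<bar> \<le> pi \<and> \<bar>E x\<bar> \<le> pi then cis (D x) else - 1)" for x
  have "continuous_on ({x \<in> ?T. \<bar>D x\<bar> \<le> pi \<and> \<bar>E x\<bar> \<le> pi} \<union> {x \<in> ?T. \<bar>D x\<bar> \<ge> pi \<or> \<bar>E x\<bar> \<ge> pi}) P"
    unfolding P_def
  proof (rule continuous_on_cases)
    have "closed ({x \<in> ?T. \<bar>D x\<bar> \<le> pi} \<inter> {x \<in> ?T. \<bar>E x\<bar> \<le> pi})"
      by (intro closed_Int continuous_on_closed_Collect_le clT continuous_intros cD cE)
    moreover have "{x \<in> ?T. \<bar>D x\<bar> \<le> pi} \<inter> {x \<in> ?T. \<bar>E x\<bar> \<le> pi} = {x \<in> ?T. \<bar>D x\<bar> \<le> pi \<and> \<bar>E x\<bar> \<le> pi}" by blast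
    ultimately show "closed {x \<in> ?T. \<bar>D x\<bar> \<le> pi \<and> \<bar>E x\<bar> \<le> pi}" by simp
    have "closed ({x \<in> ?T. pi \<le> \<bar>D x\<bar>} \<union> {x \<in> ?T. pi \<le> \<bar>E x\<bar>})"
      by (intro closed_Un continuous_on_closed_Collect_le clT continuous_intros cD cE)
    moreover have "{x \<in> ?T. pi \<le> \<bar>D x\<bar>} \<union> {x \<in> ?T. pi \<le> \<bar>E x\<bar>} = {x \<in> ?T. \<bar>D x\<bar> \<ge> pi \<or> \<bar>E x\<bar> \<ge> pi}" by blast
    ultimately show "closed {x \<in> ?T. \<bar>D x\<bar> \<ge> pi \<or> \<bar>E x\<bar> \<ge> pi}" by simp
    show "continuous_on {x \<in> ?T. \<bar>D x\<bar> \<le> pi \<and> \<bar>E x\<bar> \<le> pi} (\<lambda>x. cis (D x))"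
      by (intro continuous_intros continuous_on_subset[OF cD]) auto
    show "\<forall>x. x \<in> {x \<in> ?T. \<bar>D x\<bar> \<le> pi \<and> \<bar>E x\<bar> \<le> pi} \<and> \<not> (\<bar>D x\<bar> \<le> pi \<and> \<bar>E x\<bar> \<le> pi) \<or>
      x \<in> {x \<in> ?T. \<bar>D x\<bar> \<ge> pi \<or> \<bar>E x\<bar> \<ge> pi} \<and> \<bar>D x\<bar> \<le> pi \<and> \<bar>E x\<bar> \<le> pi \<longrightarrow> cis (D x) = - 1"
    proof (intro allI impI)
      fix x
      assume "x \<in> {x \<in> ?T. \<bar>D x\<bar> \<le> pi \<and> \<bar>E x\<bar> \<le> pi} \<and> \<not> (\<bar>D x\<bar> \<le> pi \<and> \<bar>E x\<bar> \<le> pi) \<or>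
        x \<in> {x \<in> ?T. \<bar>D x\<bar> \<ge> pi \<or> \<bar>E x\<bar> \<ge> pi} \<and> \<bar>D x\<bar> \<le> pi \<and> \<bar>E x\<bar> \<le> pi"
      then have "\<bar>D x\<bar> = pi" by (intro bdry) auto
      then show "cis (D x) = - 1" by (rule cis_pi')
    qed
  qed (rule continuous_on_const)
  moreover have "{x \<in> ?T. \<bar>D x\<bar> \<le> pi \<and> \<bar>E x\<bar> \<le> pi} \<union> {x \<in> ?T. \<bar>D x\<bar> \<ge> pi \<or> \<bar>E x\<bar> \<ge> pi} = ?T" by auto
  ultimately have cP: "continuous_on ?T P" by simp
  have P0: "P x \<noteq> 0" for x by (simp add: P_def)
  obtain g where g: "continuous_on ?T g" "\<And>x. x \<in> ?T \<Longrightarrow> P x = exp (g x)"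
    using continuous_logarithm_on_contractible[OF cP convex_imp_contractible[OF cvT] P0] by blast
  define \<psi> where "\<psi> x = Im (g x)" for x
  have c\<psi>: "continuous_on ?T \<psi>" unfolding \<psi>_def by (intro continuous_intros g)
  have P\<psi>: "P x = cis (\<psi> x)" if "x \<in> ?T" for x
  proof -
    have "norm (P x) = 1" by (simp add: P_def)
    then have "exp (Re (g x)) = 1" using g(2)[OF that] by simp
    then show ?thesis using g(2)[OF that] by (simp add: \<psi>_def exp_eq_polar)
  qed
  \<comment> \<open>On the edges \<open>m = p\<close> and \<open>m = m'\<close> of the triangle,
    \<open>E\<close> equals \<open>D\<close> or 0, so \<open>P\<close> depends on \<open>D\<close>
    alone; \<open>clip\<close> is an explicit lift of \<open>P\<close> there, and
    \<open>edge\<close> reads off the change of \<open>\<psi>\<close>.\<close>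
  define clip where "clip t = max (- pi) (min pi t)" for t
  have cis_clip: "cis (clip t) = (if \<bar>t\<bar> \<le> pi then cis t else -1)" for t
  proof -
    consider "t > pi" | "t < - pi" | "\<bar>t\<bar> \<le> pi" by linarith
    then show ?thesis
    proof cases
      case 1
      then have "clip t = pi" using pi_gt_zero by (simp add: clip_def)
      moreover have "\<not> \<bar>t\<bar> \<le> pi" using 1 by linarith
      ultimately show ?thesis using cis_pi'[of pi] by simp
    next
      case 2
      then have "clip t = - pi" using pi_gt_zero by (simp add: clip_def)
      moreover have "\<not> \<bar>t\<bar> \<le> pi" using 2 by linarith
      ultimately show ?thesis using cis_pi'[of "- pi"] by simp
    next
      case 3
      then have "clip t = t" by (simp add: clip_def abs_le_iff min_def max_def)
      then show ?thesis using 3 by simp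
    qed
  qed
  have edge: "\<psi> (f q) - \<psi> (f p) = clip (e q)"
    if cf: "continuous_on {p..q} f" and fT: "\<And>m. m \<in> {p..q} \<Longrightarrow> f m \<in> ?T" and ce: "continuous_on {p..q} e" and e0: "e p = 0"
      and Pe: "\<And>m. m \<in> {p..q} \<Longrightarrow> P (f m) = (if \<bar>e m\<bar> \<le> pi then cis (e m) else -1)" for f e
  proof -
    have "\<psi> (f p) - clip (e p) = \<psi> (f q) - clip (e q)"
    proof (rule continuous_cis_eq_1_imp_constant[of "{p..q}" "\<lambda>m. \<psi> (f m) - clip (e m)"])
      show "continuous_on {p..q} (\<lambda>m. \<psi> (f m) - clip (e m))"
      proof (rule continuous_on_diff)
        show "continuous_on {p..q} (\<lambda>m. \<psi> (f m))"
          by (rule continuous_on_compose2[OF c\<psi> cf]) (rule image_subsetI, rule fT)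
        show "continuous_on {p..q} (\<lambda>m. clip (e m))"
          unfolding clip_def by (intro continuous_on_max continuous_on_min continuous_on_const ce)
      qed
      show "cis (\<psi> (f m) - clip (e m)) = 1" if m: "m \<in> {p..q}" for m
      proof -
        have "cis (\<psi> (f m)) = P (f m)" by (rule P\<psi>[OF fT[OF m], symmetric])
        also have "\<dots> = cis (clip (e m))" by (simp only: Pe[OF m] cis_clip)
        finally show ?thesis by (simp only: cis_divide[symmetric]) simp
      qed
    qed (use \<open>p < q\<close> in auto)
    then show ?thesis unfolding e0 by (simp add: clip_def)
  qed
  have "\<psi> (p, q) - \<psi> (p, p) = clip (a p q - a p p)"
  proof (rule edge[of "\<lambda>m. (p, m)" "\<lambda>m. a p m - a p p"])
    show "P (p, m) = (if \<bar>a p m - a p p\<bar> \<le> pi then cis (a p m - a p p) else -1)" for m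
      by (simp add: P_def D_def E_def)
  qed (auto intro!: continuous_intros ca)
  moreover have "a p q - a p p < 0" using gt[of p p] \<open>p < q\<close> by simp
  ultimately have 1: "\<psi> (p, q) < \<psi> (p, p)" using pi_gt_zero unfolding clip_def by linarith
  have "\<psi> (q, q) - \<psi> (p, p) = clip (a q q - a p q)"
  proof (rule edge[of "\<lambda>m. (m, m)" "\<lambda>m. a m m - a p m"])
    show "P (m, m) = (if \<bar>a m m - a p m\<bar> \<le> pi then cis (a m m - a p m) else -1)" for m
      by (simp add: P_def D_def E_def)
  qed (auto intro!: continuous_intros ca)
  moreover have "a q q - a p q > 0" using gt[of q q] \<open>p < q\<close> by simp
  ultimately have 2: "\<psi> (p, p) < \<psi> (q, q)" using pi_gt_zero unfolding clip_def by linarith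
  \<comment> \<open>The corners \<open>(p, q)\<close> and \<open>(q, q)\<close> lie on opposite
    sides of the value at \<open>(p, p)\<close>, so the third edge takes that value.\<close>
  have "continuous_on {p..q} (\<lambda>m. \<psi> (m, q))"
    by (rule continuous_on_compose2[OF c\<psi>]) (auto intro!: continuous_intros)
  then obtain m where m: "p \<le> m" "m \<le> q" "\<psi> (m, q) = \<psi> (p, p)"
    using IVT'[of "\<lambda>m. \<psi> (m, q)" p "\<psi> (p, p)" q] 1 2 \<open>p < q\<close> by auto
  have "P (m, q) = P (p, p)" using m \<open>p < q\<close> by (simp add: P\<psi>)
  then have "P (m, q) = 1" by (simp add: P_def DEpp)
  then have "D (m, q) = 0 \<and> E (m, q) = 0"
    using zero[of "(m, q)"] m by (auto simp: P_def split: if_splits)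
  \<comment> \<open>\<open>E = 0\<close> says \<open>a p q = a p m\<close>, which \<open>gt\<close>
    allows only for \<open>m = q\<close>; then \<open>D = 0\<close> says
    \<open>a q q = a p q\<close>, again excluded.\<close>
  then show False using gt[of p m] gt[of m q] m \<open>p < q\<close> by (cases "m = q") (auto simp: D_def E_def)
qed

text \<open>Take a pair of parameters with the given chord angle at minimal distance: if it were not on the
  diagonal, all shorter chords would lie strictly on one side.\<close>

theorem chord_angle_mean_value:
  assumes a: "chord_angles R a p q" and "p \<le> q"
  obtains s where "p \<le> s" "s \<le> q" "a s s = a p q"
proof -
  let ?T = "{(m, m'). p \<le> m \<and> m \<le> m' \<and> m' \<le> q}"
  have c: "continuous_on ?T (\<lambda>(m, m'). a m m')" by (rule chord_anglesD(1)[OF a])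
  have T: "?T = {x. p \<le> fst x} \<inter> {x. fst x \<le> snd x} \<inter> {x. snd x \<le> q}" by auto
  then have clT: "closed ?T" by (auto intro!: closed_Int closed_Collect_le continuous_intros)
  define Z where "Z = {x \<in> ?T. (\<lambda>(m, m'). a m m') x = a p q}"
  have "closed Z" unfolding Z_def
    using continuous_closed_preimage_constant[OF c clT] by simp
  moreover have "bounded Z"
    by (rule bounded_subset[of "{p..q} \<times> {p..q}"]) (auto simp: Z_def intro: bounded_Times)
  ultimately have "compact Z" by (simp add: compact_eq_bounded_closed)
  moreover have "(p, q) \<in> Z" using \<open>p \<le> q\<close> by (simp add: Z_def)
  moreover have "continuous_on Z (\<lambda>x. snd x - fst x)" by (intro continuous_intros)
  ultimately obtain x where x: "x \<in> Z" "\<And>y. y \<in> Z \<Longrightarrow> snd x - fst x \<le> snd y - fst y"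
    using continuous_attains_inf[of Z "\<lambda>x. snd x - fst x"] by blast
  obtain s t where st: "x = (s, t)" by force
  have s: "p \<le> s" "s \<le> t" "t \<le> q" "a s t = a p q" using x(1) st by (auto simp: Z_def)
  show thesis
  proof (cases "s = t")
    case True
    then show ?thesis using that s by blast
  next
    case False
    then have "s < t" using s by simp
    let ?U = "{(m, m'). s \<le> m \<and> m \<le> m' \<and> m' \<le> t \<and> (m, m') \<noteq> (s, t)}"
    \<comment> \<open>In the triangle only the corner \<open>(s, t)\<close> has
      \<open>m' - m\<close> equal to \<open>t - s\<close>, so removing it amounts to a strict linear
      inequality and keeps convexity.\<close>
    have U: "?U = {x. s \<le> fst x} \<inter> {x. fst x - snd x \<le> 0} \<inter> {x. snd x \<le> t} \<inter> {x. snd x - fst x < t - s}" by auto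
    have "convex ?U"
      unfolding convex_alt U
    proof clarsimp
      fix m m' n n' r :: real
      assume *: "s \<le> m" "m \<le> m'" "m' \<le> t" "s \<le> n" "n \<le> n'" "n' \<le> t" "0 \<le> r" "r \<le> 1"
        "m' - m < t - s" "n' - n < t - s"
      have "(1 - r) * s \<le> (1 - r) * m" "r * s \<le> r * n" "(1 - r) * m \<le> (1 - r) * m'" "r * n \<le> r * n'"
        "(1 - r) * m' \<le> (1 - r) * t" "r * n' \<le> r * t"
        using * by (auto intro!: mult_left_mono)
      moreover have "(1 - r) * (m' - m) + r * (n' - n) < (1 - r) * (t - s) + r * (t - s)"
      proof (cases "r = 0")
        case False
        then show ?thesis using * by (intro add_le_less_mono mult_left_mono mult_strict_left_mono) auto
      qed (use * in auto)
      ultimately show "s \<le> (1 - r) * m + r * n \<and> (1 - r) * m + r * n \<le> (1 - r) * m' + r * n' \<and>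
          (1 - r) * m' + r * n' \<le> t \<and> (1 - r) * m' + r * n' - ((1 - r) * m + r * n) < t - s"
        by (simp add: algebra_simps)
    qed
    then have "connected ((\<lambda>(m, m'). a m m') ` ?U)"
      by (intro connected_continuous_image convex_connected continuous_on_subset[OF c]) (use s in auto)
    moreover have "a p q \<notin> (\<lambda>(m, m'). a m m') ` ?U"
    proof
      assume "a p q \<in> (\<lambda>(m, m'). a m m') ` ?U"
      then obtain m m' where mm: "s \<le> m" "m \<le> m'" "m' \<le> t" "(m, m') \<noteq> (s, t)" "a m m' = a p q" by auto
      then have "t - s \<le> m' - m" using x(2)[of "(m, m')"] s st by (auto simp: Z_def)
      then show False using mm by auto
    qed
    ultimately have "(\<forall>y \<in> (\<lambda>(m, m'). a m m') ` ?U. y > a p q) \<or> (\<forall>y \<in> (\<lambda>(m, m'). a m m') ` ?U. y < a p q)"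
      by (rule connected_avoids_value)
    then consider "\<And>m m'. (m, m') \<in> ?U \<Longrightarrow> a m m' > a s t" | "\<And>m m'. (m, m') \<in> ?U \<Longrightarrow> a m m' < a s t"
      using s(4) by fastforce
    then have False
    proof cases
      case 1
      then show False
        using chord_angles_not_minimal[OF chord_angles_subset[OF a s(1,3)] \<open>s < t\<close>] by blast
    next
      case 2
      then show False
        using chord_angles_not_minimal[OF chord_angles_uminus[OF chord_angles_subset[OF a s(1,3)]] \<open>s < t\<close>] by auto
    qed
    then show ?thesis ..
  qed
qed

section \<open>Angle variation of plane curves\<close>

definition cpx :: "plane \<Rightarrow> complex" where
  "cpx u = Complex (u $ 1) (u $ 2)"

lemma cpx_linear: "linear cpx"
  by (rule linearI) (auto simp: cpx_def complex_eq_iff)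

lemmas cpx_simps = linear_add[OF cpx_linear] linear_diff[OF cpx_linear] linear_scale[OF cpx_linear] linear_0[OF cpx_linear]

lemma norm_cpx [simp]: "norm (cpx u) = norm u"
  by (simp add: cpx_def norm_vec_def L2_set_def sum_2 cmod_def)

lemma cpx_eq_0_iff [simp]: "cpx u = 0 \<longleftrightarrow> u = 0"
  by (metis norm_cpx norm_eq_zero)

lemma cpx_eq_iff: "cpx u = cpx v \<longleftrightarrow> u = v"
  using cpx_eq_0_iff[of "u - v"] by (simp add: cpx_simps)

lemma cpx_sgn: "cpx (sgn u) = sgn (cpx u)"
  by (simp add: sgn_div_norm cpx_simps)

lemma continuous_on_cpx [continuous_intros]: "continuous_on S f \<Longrightarrow> continuous_on S (\<lambda>x. cpx (f x))"
  using continuous_on_compose2[OF linear_continuous_on[OF cpx_linear[unfolded linear_conv_bounded_linear], of UNIV]] by auto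

lemma angle_lift_iff:
  "angle_lift w v \<longleftrightarrow> continuous_on {0..} v \<and> (\<forall>t\<ge>0. sgn (cpx (w t)) = cis (v t))"
proof -
  have "norm (vector [1, 0] :: plane) = 1" by (simp add: norm_vec_def L2_set_def sum_2)
  then have "sgn (vector [1, 0] :: plane) = vector [1, 0]" by (simp add: sgn_div_norm)
  then have "a \<in> oriented_angle (vector [1, 0]) u \<longleftrightarrow> cpx (sgn u) = cis a" for a u
    by (simp add: oriented_angle_def rotation_ccw_def cpx_def vec_eq_iff forall_2 complex_eq_iff)
  then show ?thesis by (simp add: angle_lift_def cpx_sgn)
qed

lemma angle_variation_eq_lift:
  assumes "angle_lift w v" "0 \<le> s"
  shows "angle_variation w s = v s - v 0"
  unfolding angle_variation_def
proof (rule the_equality)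
  fix d assume "\<exists>v'. angle_lift w v' \<and> d = v' s - v' 0"
  then obtain v' where v': "angle_lift w v'" "d = v' s - v' 0" by blast
  have "v' 0 - v 0 = v' s - v s"
  proof (rule continuous_cis_eq_1_imp_constant[of "{0..}" "\<lambda>t. v' t - v t"])
    show "continuous_on {0..} (\<lambda>t. v' t - v t)"
      using assms v' by (auto simp: angle_lift_iff intro: continuous_intros)
    show "cis (v' t - v t) = 1" if "t \<in> {0..}" for t
    proof -
      have "cis (v' t) = cis (v t)" using assms(1) v'(1) that by (simp add: angle_lift_iff)
      then show ?thesis using cis_divide[of "v' t" "v t"] by simp
    qed
  qed (use assms in \<open>auto simp: convex_connected\<close>)
  then show "d = v s - v 0" using v' by simp
qed (use assms in blast)

lemma angle_variation_eqI:
  assumes "continuous_on {0..} v" "v 0 = 0" "w 0 \<noteq> 0"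
    and "\<And>t. 0 \<le> t \<Longrightarrow> sgn (cpx (w t)) = sgn (cpx (w 0)) * cis (v t)"
    and "0 \<le> s"
  shows "angle_variation w s = v s"
proof -
  have "sgn (cpx (w 0)) = cis (Arg (cpx (w 0)))" using assms(3) by (simp add: cis_Arg)
  then have "sgn (cpx (w t)) = cis (Arg (cpx (w 0)) + v t)" if "0 \<le> t" for t
    unfolding assms(4)[OF that] by (simp add: cis_mult)
  then have "angle_lift w (\<lambda>t. Arg (cpx (w 0)) + v t)"
    unfolding angle_lift_iff using assms(1) by (auto intro!: continuous_intros)
  from angle_variation_eq_lift[OF this assms(5)] show ?thesis using assms(2) by simp
qed

text \<open>Contracting time by \<open>r * t\<close> deforms the quotient of \<open>w p t\<close> by
  \<open>w p 0\<close> to the constant 1 through nonzero values. Hence it has a continuous logarithm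
  whatever the topology of \<open>S\<close>, and the lifts are jointly continuous in
  \<open>p\<close> and \<open>t\<close>.\<close>

theorem angle_variation_family:
  fixes w :: "'a::real_normed_vector \<Rightarrow> real \<Rightarrow> plane"
  assumes cw: "continuous_on (S \<times> {0..}) (\<lambda>(p, t). w p t)"
    and nz: "\<And>p t. p \<in> S \<Longrightarrow> 0 \<le> t \<Longrightarrow> w p t \<noteq> 0"
  shows "continuous_on (S \<times> {0..}) (\<lambda>(p, t). angle_variation (w p) t)"
    and "p \<in> S \<Longrightarrow> 0 \<le> t \<Longrightarrow> sgn (cpx (w p t)) = sgn (cpx (w p 0)) * cis (angle_variation (w p) t)"
proof -
  define Q where "Q = (\<lambda>(p, t). cpx (w p t) / cpx (w p 0))"
  have cwc: "continuous_on X (\<lambda>x. w (f x) (g x))"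
    if "continuous_on X f" "continuous_on X g" "\<And>x. x \<in> X \<Longrightarrow> f x \<in> S" "\<And>x. x \<in> X \<Longrightarrow> 0 \<le> g x"
    for X :: "'b::topological_space set" and f g
    using continuous_on_compose2[OF cw continuous_on_Pair[OF that(1,2)]] that(3,4) by auto
  have "homotopic_with_canon (\<lambda>h. True) (S \<times> {0..}) (- {0}) (\<lambda>x. 1) Q"
  proof -
    let ?h = "\<lambda>(r, p, t). cpx (w p (r * t)) / cpx (w p 0)"
    have "continuous_on ({0..1} \<times> S \<times> {0..}) ?h"
      unfolding case_prod_unfold using nz
      by (auto intro!: continuous_intros cwc)
    moreover have "?h ` ({0..1} \<times> S \<times> {0..}) \<subseteq> - {0}" using nz by auto
    moreover have "?h (0, x) = 1" "?h (1, x) = Q x" if "x \<in> S \<times> {0..}" for x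
      using that nz by (auto simp: Q_def)
    moreover have "w p (r * t) \<noteq> 0" if "p \<in> S" "0 \<le> r" "0 \<le> t" for p r t using nz that by simp
    ultimately show ?thesis
      by (subst homotopic_with) (auto intro!: exI[of _ ?h] simp: nz)
  qed
  then have "\<exists>a. homotopic_with_canon (\<lambda>h. True) (S \<times> {0..}) (- {0}) Q (\<lambda>x. a)"
    using homotopic_with_sym by blast
  then obtain g where g: "continuous_on (S \<times> {0..}) g" "\<And>x. x \<in> S \<times> {0..} \<Longrightarrow> Q x = exp (g x)"
    using inessential_eq_continuous_logarithm[of "S \<times> {0..}" Q] by blast
  define v where "v p t = Im (g (p, t)) - Im (g (p, 0))" for p t
  have cg: "continuous_on X (\<lambda>x. g (h x, k x))"
    if "continuous_on X h" "continuous_on X k" "\<And>x. x \<in> X \<Longrightarrow> h x \<in> S" "\<And>x. x \<in> X \<Longrightarrow> 0 \<le> k x"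
    for X :: "'b::topological_space set" and h k
    using continuous_on_compose2[OF g(1) continuous_on_Pair[OF that(1,2)]] that(3,4) by auto
  have cv: "continuous_on (S \<times> {0..}) (\<lambda>(p, t). v p t)"
    unfolding v_def case_prod_unfold by (auto intro!: continuous_intros cg g(1))
  have cis_g: "sgn (cpx (w p t)) = sgn (cpx (w p 0)) * cis (Im (g (p, t)))" if "p \<in> S" "0 \<le> t" for p t
  proof -
    have "cpx (w p t) = cpx (w p 0) * exp (g (p, t))"
      using g(2)[of "(p, t)"] nz[of p 0] that by (simp add: Q_def field_simps)
    then have "sgn (cpx (w p t)) = sgn (cpx (w p 0)) * sgn (exp (g (p, t)))" by (simp add: sgn_mult)
    also have "sgn (exp (g (p, t))) = exp (g (p, t)) / of_real (exp (Re (g (p, t))))"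
      by (simp only: sgn_eq norm_exp_eq_Re)
    also have "\<dots> = cis (Im (g (p, t)))" by (subst exp_eq_polar) simp
    finally show ?thesis .
  qed
  have v: "sgn (cpx (w p t)) = sgn (cpx (w p 0)) * cis (v p t)" if "p \<in> S" "0 \<le> t" for p t
  proof -
    have "sgn (cpx (w p 0)) \<noteq> 0" using nz[of p 0] that by (simp add: sgn_zero_iff)
    then have "cis (Im (g (p, 0))) = 1" using cis_g[of p 0] that by simp
    then have "cis (v p t) = cis (Im (g (p, t)))" by (simp add: v_def cis_divide[symmetric])
    then show ?thesis using cis_g[OF that] by simp
  qed
  have av: "angle_variation (w p) t = v p t" if "p \<in> S" "0 \<le> t" for p t
  proof (rule angle_variation_eqI[OF _ _ _ _ that(2)])
    show "continuous_on {0..} (v p)"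
      using that unfolding v_def by (auto intro!: continuous_intros cg)
    show "sgn (cpx (w p t)) = sgn (cpx (w p 0)) * cis (v p t)" if "0 \<le> t" for t
      by (rule v[OF \<open>p \<in> S\<close> that])
  qed (use that nz in \<open>auto simp: v_def\<close>)
  show "continuous_on (S \<times> {0..}) (\<lambda>(p, t). angle_variation (w p) t)"
    using cv by (rule continuous_on_eq) (auto simp: av)
  show "p \<in> S \<Longrightarrow> 0 \<le> t \<Longrightarrow> sgn (cpx (w p t)) = sgn (cpx (w p 0)) * cis (angle_variation (w p) t)"
    by (subst av, assumption, assumption, rule v)
qed

locale plane_curve =
  fixes w :: "real \<Rightarrow> plane"
  assumes continuous: "continuous_on {0..} w" and nonzero: "0 \<le> t \<Longrightarrow> w t \<noteq> 0"
begin

lemma angle_variation: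
  shows "continuous_on {0..} (angle_variation w)"
    and "0 \<le> t \<Longrightarrow> sgn (cpx (w t)) = sgn (cpx (w 0)) * cis (angle_variation w t)"
proof -
  have "continuous_on (UNIV \<times> {0..}) (\<lambda>(p :: real, t). w t)"
    unfolding case_prod_unfold by (rule continuous_on_compose2[OF continuous]) (auto intro!: continuous_intros)
  note * = angle_variation_family[OF this nonzero]
  have "continuous_on {0..} (\<lambda>t. (\<lambda>(p :: real, t). angle_variation w t) (0, t))"
    by (rule continuous_on_compose2[OF *(1)]) (auto intro!: continuous_intros)
  then show "continuous_on {0..} (angle_variation w)" by simp
  show "0 \<le> t \<Longrightarrow> sgn (cpx (w t)) = sgn (cpx (w 0)) * cis (angle_variation w t)"
    using *(2)[of 0 t] by auto
qed

lemma angle_variation_0: "angle_variation w 0 = 0"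
proof -
  have "sgn (cpx (w 0)) = cis (Arg (cpx (w 0)))" using nonzero[of 0] by (simp add: cis_Arg)
  then have "sgn (cpx (w t)) = cis (Arg (cpx (w 0)) + angle_variation w t)" if "0 \<le> t" for t
    unfolding angle_variation(2)[OF that] by (simp add: cis_mult)
  then have "angle_lift w (\<lambda>t. Arg (cpx (w 0)) + angle_variation w t)"
    unfolding angle_lift_iff using angle_variation(1) by (auto intro!: continuous_intros)
  from angle_variation_eq_lift[OF this, of 0] show ?thesis by simp
qed

lemma angle_variation_shift:
  assumes "0 \<le> a" "0 \<le> s"
  shows "angle_variation (\<lambda>t. w (t + a)) s = angle_variation w (s + a) - angle_variation w a"
proof (rule angle_variation_eqI)
  show "continuous_on {0..} (\<lambda>t. angle_variation w (t + a) - angle_variation w a)"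
    by (intro continuous_intros continuous_on_compose2[OF angle_variation(1)]) (use assms in auto)
  show "sgn (cpx (w (t + a))) = sgn (cpx (w (0 + a))) * cis (angle_variation w (t + a) - angle_variation w a)"
    if "0 \<le> t" for t
    using angle_variation(2)[of "t + a"] angle_variation(2)[of a] that assms
    by (simp add: cis_divide[symmetric])
qed (use assms nonzero in auto)

lemma angle_variation_scale:
  assumes "c \<noteq> 0" "0 \<le> s"
  shows "angle_variation (\<lambda>t. c *\<^sub>R w t) s = angle_variation w s"
proof (rule angle_variation_eqI)
  show "sgn (cpx (c *\<^sub>R w t)) = sgn (cpx (c *\<^sub>R w 0)) * cis (angle_variation w t)" if "0 \<le> t" for t
    using angle_variation(2)[OF that] by (simp add: cpx_simps sgn_scaleR)
qed (use assms angle_variation angle_variation_0 nonzero in auto)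

end

text \<open>The angle between two curves that are never collinear avoids the multiples of \<open>pi\<close>.\<close>

lemma angle_variation_close:
  assumes "plane_curve w" "plane_curve w'" and s: "0 \<le> s"
    and indep: "\<And>t c. 0 \<le> t \<Longrightarrow> w' t \<noteq> c *\<^sub>R w t"
  shows "\<bar>angle_variation w s - angle_variation w' s\<bar> \<le> pi"
proof (rule ccontr)
  interpret w: plane_curve w by fact
  interpret w': plane_curve w' by fact
  assume far: "\<not> ?thesis"
  \<comment> \<open>With this initial angle added, \<open>f t\<close> is a real determination of the
    angle from \<open>w t\<close> to \<open>w' t\<close>.\<close>
  define c where "c = Arg (cpx (w' 0)) - Arg (cpx (w 0))"
  define f where "f t = angle_variation w' t - angle_variation w t + c" for t
  have cf: "continuous_on {0..s} f" unfolding f_def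
    by (intro continuous_intros continuous_on_subset[OF w.angle_variation(1)] continuous_on_subset[OF w'.angle_variation(1)]) auto
  have sin_f: "sin (f t) \<noteq> 0" if t: "0 \<le> t" for t
  proof
    assume "sin (f t) = 0"
    then have "cis (f t) = 1 \<or> cis (f t) = -1"
      using sin_zero_abs_cos_one[of "f t"] by (auto simp: complex_eq_iff abs_if split: if_splits)
    moreover have "sgn (cpx (w' t)) = sgn (cpx (w t)) * cis (f t)"
    proof -
      have "sgn (cpx (w 0)) = cis (Arg (cpx (w 0)))" "sgn (cpx (w' 0)) = cis (Arg (cpx (w' 0)))"
        using w.nonzero[of 0] w'.nonzero[of 0] by (simp_all add: cis_Arg)
      then show ?thesis using w.angle_variation(2)[OF t] w'.angle_variation(2)[OF t]
        by (simp add: cis_mult f_def c_def add.commute)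
    qed
    ultimately have "cpx (sgn (w' t)) = cpx (sgn (w t)) \<or> cpx (sgn (w' t)) = cpx (- sgn (w t))"
      by (auto simp: cpx_sgn linear_neg[OF cpx_linear])
    then have "sgn (w' t) = sgn (w t) \<or> sgn (w' t) = - sgn (w t)"
      using cpx_eq_iff by blast
    moreover have nw': "w' t = norm (w' t) *\<^sub>R sgn (w' t)" using w'.nonzero[OF t] by (simp add: sgn_div_norm)
    ultimately show False
    proof (elim disjE)
      assume e: "sgn (w' t) = sgn (w t)"
      have "w' t = norm (w' t) *\<^sub>R sgn (w t)" using nw' unfolding e .
      also have "\<dots> = (norm (w' t) / norm (w t)) *\<^sub>R w t" by (simp add: sgn_div_norm divide_inverse)
      finally show False using indep[OF t] by blast
    next
      assume e: "sgn (w' t) = - sgn (w t)"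
      have "w' t = norm (w' t) *\<^sub>R - sgn (w t)" using nw' unfolding e .
      also have "\<dots> = (- norm (w' t) / norm (w t)) *\<^sub>R w t" by (simp add: sgn_div_norm divide_inverse)
      finally show False using indep[OF t] by blast
    qed
  qed
  have "f 0 = c" by (simp add: f_def w.angle_variation_0 w'.angle_variation_0)
  then have "\<bar>f s - f 0\<bar> > pi" using far by (simp add: f_def)
  \<comment> \<open>An interval of length at least \<open>pi\<close> contains a multiple of
    \<open>pi\<close>, which the continuous \<open>f\<close> would have to attain.\<close>
  have mult: "\<exists>n :: int. x \<le> n * pi \<and> n * pi \<le> y" if "x + pi \<le> y" for x y :: real
  proof -
    let ?n = "\<lceil>x / pi\<rceil>"
    have "x / pi \<le> ?n" "?n < x / pi + 1" by linarith+
    then have "x \<le> ?n * pi" "?n * pi < (x / pi + 1) * pi"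
      using pos_divide_le_eq[OF pi_gt_zero, of x ?n] mult_strict_right_mono[OF _ pi_gt_zero] by blast+
    moreover have "(x / pi + 1) * pi = x + pi" by (simp add: distrib_right)
    ultimately show ?thesis using that by (intro exI[of _ ?n]) linarith
  qed
  consider "f 0 + pi \<le> f s" | "f s + pi \<le> f 0" using \<open>\<bar>f s - f 0\<bar> > pi\<close> by linarith
  then obtain t and n :: int where "0 \<le> t" "f t = n * pi"
  proof cases
    case 1
    then obtain n :: int where "f 0 \<le> n * pi" "n * pi \<le> f s" using mult by blast
    from IVT'[OF this s cf] show ?thesis using that by blast
  next
    case 2
    then obtain n :: int where "f s \<le> n * pi" "n * pi \<le> f 0" using mult by blast
    from IVT2'[OF this s cf] show ?thesis using that by blast
  qed
  then show False using sin_f[of t] sin_zero_iff_int2[of "f t"] by blast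
qed

section \<open>Isotopies\<close>

lemma jacobian_has_derivative:
  "f differentiable (at z) \<Longrightarrow> (f has_derivative (\<lambda>h. jacobian f (at z) *v h)) (at z)"
  for f :: "real^'n \<Rightarrow> real^'m"
  by (simp add: jacobian_works)

lemma jacobian_eqI:
  fixes f :: "real^'n \<Rightarrow> real^'m"
  assumes "(f has_derivative (\<lambda>h. A *v h)) (at z)"
  shows "jacobian f (at z) = A"
  using frechet_derivative_at[OF assms] matrix_of_matrix_vector_mul[of A] by (simp add: jacobian_def)

lemma jacobian_compose:
  fixes f :: "real^'n \<Rightarrow> real^'m" and g :: "real^'k \<Rightarrow> real^'n"
  assumes "f differentiable (at (g z))" "g differentiable (at z)"
  shows "jacobian (f \<circ> g) (at z) = jacobian f (at (g z)) ** jacobian g (at z)"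
  using diff_chain_at[OF jacobian_has_derivative[OF assms(2)] jacobian_has_derivative[OF assms(1)]]
  by (intro jacobian_eqI) (simp add: o_def matrix_vector_mul_assoc)

lemma jacobian_id: "jacobian (id :: real^'n \<Rightarrow> real^'n) (at z) = mat 1"
  by (intro jacobian_eqI) (simp add: id_def)

lemma continuous_on_matrix_mult [continuous_intros]:
  fixes A :: "'a::topological_space \<Rightarrow> real^'n^'m" and B :: "'a \<Rightarrow> real^'k^'n"
  shows "continuous_on S A \<Longrightarrow> continuous_on S B \<Longrightarrow> continuous_on S (\<lambda>x. A x ** B x)"
  unfolding matrix_matrix_mult_def by (intro continuous_intros)

lemma continuous_on_matrix_vector_mult' [continuous_intros]:
  fixes A :: "'a::topological_space \<Rightarrow> real^'n^'m" and v :: "'a \<Rightarrow> real^'n"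
  shows "continuous_on S A \<Longrightarrow> continuous_on S v \<Longrightarrow> continuous_on S (\<lambda>x. A x *v v x)"
  unfolding matrix_vector_mult_def by (intro continuous_intros)

lemma C1_map_compose:
  assumes f: "C1_map f" and g: "C1_map g"
  shows "C1_map (f \<circ> g)"
proof -
  have dg: "g differentiable (at z)" and df: "f differentiable (at z)" for z
    using assms by (auto simp: C1_map_def)
  have cg: "continuous_on UNIV g"
    using dg by (auto simp: continuous_on_eq_continuous_within intro: differentiable_imp_continuous_within)
  have "continuous_on UNIV (\<lambda>z. jacobian f (at (g z)) ** jacobian g (at z))"
    using assms cg unfolding C1_map_def
    by (intro continuous_intros continuous_on_compose2[of UNIV "\<lambda>z. jacobian f (at z)" UNIV g]) auto
  then show ?thesis
    using jacobian_compose[OF df dg] differentiable_chain_at[OF dg df] by (simp add: C1_map_def)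
qed

lemma Diff1_compose:
  assumes "f \<in> Diff1" "g \<in> Diff1"
  shows "f \<circ> g \<in> Diff1"
proof -
  have "inv (f \<circ> g) = inv g \<circ> inv f" using assms by (intro o_inv_distrib) (auto simp: Diff1_def)
  then show ?thesis using assms by (auto simp: Diff1_def intro: bij_comp C1_map_compose)
qed

lemma Diff1_id: "id \<in> Diff1"
  by (auto simp: Diff1_def C1_map_def jacobian_id differentiable_def intro!: exI[of _ id] has_derivative_id)

lemma Diff1_funpow: "f \<in> Diff1 \<Longrightarrow> f ^^ n \<in> Diff1"
  by (induction n) (auto simp: Diff1_id Diff1_compose simp flip: id_def)

lemma Diff1D:
  assumes "f \<in> Diff1"
  shows "bij f" "inj f" "f differentiable (at z)" "continuous_on UNIV (\<lambda>z. jacobian f (at z))" "continuous_on UNIV f"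
proof -
  show d: "bij f" "f differentiable (at z)" "continuous_on UNIV (\<lambda>z. jacobian f (at z))" for z
    using assms by (auto simp: Diff1_def C1_map_def)
  show "inj f" using d(1) by (simp add: bij_def)
  show "continuous_on UNIV f"
    using d(2) by (auto simp: continuous_on_eq_continuous_within intro: differentiable_imp_continuous_within)
qed

lemma Diff1_jacobian_nonzero:
  assumes "f \<in> Diff1" "\<xi> \<noteq> 0"
  shows "jacobian f (at z) *v \<xi> \<noteq> 0"
proof
  assume 0: "jacobian f (at z) *v \<xi> = 0"
  have "inv f differentiable (at (f z))" using assms by (auto simp: Diff1_def C1_map_def)
  from jacobian_compose[OF this Diff1D(3)[OF assms(1)]]
  have "mat 1 = jacobian (inv f) (at (f z)) ** jacobian f (at z)"
    using Diff1D(2)[OF assms(1)] by (simp add: jacobian_id)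
  then have "\<xi> = jacobian (inv f) (at (f z)) *v (jacobian f (at z) *v \<xi>)"
    by (metis matrix_vector_mul_assoc matrix_vector_mul_lid)
  then show False using 0 assms(2) by simp
qed

text \<open>This turns the weak topology, uniform on compact sets only, into joint continuity: the
  closed unit ball around \<open>z\<close> serves as the compact set.\<close>

lemma continuous_on_prod_of_locally_uniform:
  fixes f :: "real \<Rightarrow> 'a::heine_borel \<Rightarrow> 'b::real_normed_vector"
  assumes c: "\<And>t. t \<in> S \<Longrightarrow> continuous_on UNIV (f t)"
    and u: "\<And>t K e. t \<in> S \<Longrightarrow> compact K \<Longrightarrow> e > 0 \<Longrightarrow>
      \<exists>d>0. \<forall>t'\<in>S. dist t' t < d \<longrightarrow> (\<forall>z\<in>K. norm (f t' z - f t z) < e)"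
  shows "continuous_on (UNIV \<times> S) (\<lambda>(z, t). f t z)"
  unfolding continuous_on_iff
proof (intro ballI allI impI)
  fix x :: "'a \<times> real" and e :: real assume "x \<in> UNIV \<times> S" and e: "e > 0"
  then obtain z t where x: "x = (z, t)" and t: "t \<in> S" by auto
  obtain d1 where d1: "d1 > 0" "\<And>t' z'. t' \<in> S \<Longrightarrow> dist t' t < d1 \<Longrightarrow> z' \<in> cball z 1 \<Longrightarrow> norm (f t' z' - f t z') < e / 2"
    using u[OF t compact_cball[of z 1], of "e / 2"] e by auto
  obtain d2 where d2: "d2 > 0" "\<And>z'. dist z' z < d2 \<Longrightarrow> dist (f t z') (f t z) < e / 2"
    using c[OF t] e unfolding continuous_on_iff by (metis UNIV_I half_gt_zero)
  have "dist (f t' z') (f t z) < e" if t': "t' \<in> S" "dist (z', t') (z, t) < min 1 (min d1 d2)" for z' t'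
  proof -
    have "dist z' z < 1" "dist z' z < d2" "dist t' t < d1"
      using t'(2) dist_fst_le[of "(z', t')" "(z, t)"] dist_snd_le[of "(z', t')" "(z, t)"] by auto
    then have "norm (f t' z' - f t z') < e / 2" "dist (f t z') (f t z) < e / 2"
      using d1(2)[OF t'(1)] d2(2) by (auto simp: dist_commute)
    then show ?thesis using dist_triangle[of "f t' z'" "f t z" "f t z'"] by (simp add: dist_norm)
  qed
  then show "\<exists>d>0. \<forall>x'\<in>UNIV \<times> S. dist x' x < d \<longrightarrow>
      dist (case x' of (z, t) \<Rightarrow> f t z) (case x of (z, t) \<Rightarrow> f t z) < e"
    unfolding x using d1(1) d2(1) by (intro exI[of _ "min 1 (min d1 d2)"]) auto
qed

lemma continuous_on_glue_unit_intervals: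
  fixes f :: "'a::metric_space \<times> real \<Rightarrow> 'b::metric_space"
  assumes "\<And>k::nat. continuous_on (UNIV \<times> {real k..real k + 1}) f"
  shows "continuous_on (UNIV \<times> {0..}) f"
proof -
  have n: "continuous_on (UNIV \<times> {0..real n}) f" for n
  proof (induction n)
    case 0
    show ?case by (rule continuous_on_subset[OF assms[of 0]]) auto
  next
    case (Suc n)
    have "continuous_on (UNIV \<times> {0..real n} \<union> UNIV \<times> {real n..real n + 1}) f"
      by (rule continuous_on_closed_Un) (auto intro: closed_Times Suc assms)
    then show ?case by (rule continuous_on_subset) auto
  qed
  show ?thesis unfolding continuous_on_eq_continuous_within
  proof
    fix x :: "'a \<times> real" assume x: "x \<in> UNIV \<times> {0..}"
    obtain m where m: "snd x < real m" using reals_Archimedean2 by blast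
    have "at x within UNIV \<times> {0..} = at x within UNIV \<times> {0..real m}"
      by (rule at_within_nhd[of _ "UNIV \<times> {..<real m}"]) (use m in \<open>auto intro: open_Times simp: mem_Times_iff\<close>)
    moreover have "continuous (at x within UNIV \<times> {0..real m}) f"
      using n[of m, unfolded continuous_on_eq_continuous_within, THEN bspec, of x] x m
      by (auto simp: mem_Times_iff)
    ultimately show "continuous (at x within UNIV \<times> {0..}) f" by simp
  qed
qed

section \<open>The isotopy extended to nonnegative times\<close>

locale isotopy =
  fixes Ft :: "real \<Rightarrow> plane \<Rightarrow> plane" and F :: "plane \<Rightarrow> plane"
  assumes iso: "isotopy_from_id Ft F"
begin

abbreviation E :: "real \<Rightarrow> plane \<Rightarrow> plane" where "E \<equiv> extend_isotopy Ft"
abbreviation DE :: "real \<Rightarrow> plane \<Rightarrow> real^2^2" where "DE t z \<equiv> jacobian (E t) (at z)"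

lemma Ft_0: "Ft 0 = id" and Ft_1: "Ft 1 = F"
  using iso by (auto simp: isotopy_from_id_def)

lemma continuous_map_Ft: "continuous_map (top_of_set {0..1}) weak_C1_topology Ft"
  using iso by (simp add: isotopy_from_id_def pathin_def)

lemma Ft_Diff1: "t \<in> {0..1} \<Longrightarrow> Ft t \<in> Diff1"
proof -
  assume "t \<in> {0..1}"
  then have "Ft t \<in> topspace weak_C1_topology"
    using continuous_map_image_subset_topspace[OF continuous_map_Ft] by auto
  also have "topspace weak_C1_topology \<subseteq> Diff1"
    by (auto simp: weak_C1_topology_def topology_generated_by_topspace C1_nbhd_def)
  finally show ?thesis .
qed

lemma Ft_locally_uniform:
  assumes t: "t \<in> {0..1}" and "compact K" "e > 0"
  shows "\<exists>d>0. \<forall>t'\<in>{0..1}. dist t' t < d \<longrightarrow>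
    (\<forall>z\<in>K. norm (Ft t' z - Ft t z) < e \<and> norm (jacobian (Ft t') (at z) - jacobian (Ft t) (at z)) < e)"
proof -
  have "openin weak_C1_topology (C1_nbhd (Ft t) K e)"
    unfolding weak_C1_topology_def using assms Ft_Diff1[OF t]
    by (intro topology_generated_by_Basis) blast
  from openin_continuous_map_preimage[OF continuous_map_Ft this]
  have "openin (top_of_set {0..1}) {t' \<in> {0..1}. Ft t' \<in> C1_nbhd (Ft t) K e}" by simp
  moreover have "t \<in> {t' \<in> {0..1}. Ft t' \<in> C1_nbhd (Ft t) K e}"
    using assms Ft_Diff1[OF t] by (simp add: C1_nbhd_def)
  ultimately obtain d where "d > 0" "\<And>t'. t' \<in> {0..1} \<Longrightarrow> dist t' t < d \<Longrightarrow> Ft t' \<in> C1_nbhd (Ft t) K e"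
    unfolding openin_euclidean_subtopology_iff by blast
  then show ?thesis by (intro exI[of _ d]) (auto simp: C1_nbhd_def)
qed

lemma Ft_continuous:
  "continuous_on (UNIV \<times> {0..1}) (\<lambda>(z, t). Ft t z)"
  "continuous_on (UNIV \<times> {0..1}) (\<lambda>(z, t). jacobian (Ft t) (at z))"
  by (rule continuous_on_prod_of_locally_uniform;
      use Ft_locally_uniform Diff1D(4,5)[OF Ft_Diff1] in meson)+

text \<open>The right end \<open>k + 1\<close> is included although the integer part jumps there:
  \<open>Ft 1\<close> after \<open>F ^^ k\<close> is \<open>Ft 0\<close> after
  \<open>F ^^ Suc k\<close>. The closed intervals can then be glued.\<close>

lemma E_eq:
  assumes "t \<in> {real k..real k + 1}"
  shows "E t = Ft (t - real k) \<circ> F ^^ k"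
proof (cases "t = real k + 1")
  case True
  then have "t = real (Suc k)" by simp
  then have fl: "\<lfloor>t\<rfloor> = int (Suc k)" by (simp only: floor_of_nat)
  then have "frac t = 0" using True by (simp add: frac_def)
  moreover have "nat \<lfloor>t\<rfloor> = Suc k" unfolding fl by (rule nat_int)
  ultimately have "E t = F ^^ Suc k" by (simp only: extend_isotopy_def Ft_0 Ft_1 id_o)
  then show ?thesis using True by (simp add: Ft_1)
next
  case False
  then have "\<lfloor>t\<rfloor> = int k" using assms by (auto simp: floor_eq_iff)
  then show ?thesis by (simp add: extend_isotopy_def frac_def Ft_1)
qed

lemma E_0: "E 0 = id"
  using E_eq[of 0 0] by (simp add: Ft_0)

lemma F_Diff1: "F \<in> Diff1"
  using Ft_Diff1[of 1] by (simp add: Ft_1)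

lemma unit_interval: "0 \<le> t \<Longrightarrow> \<exists>k. t \<in> {real k..real k + 1}"
proof (intro exI[of _ "nat \<lfloor>t\<rfloor>"])
  assume "0 \<le> t"
  then have "real (nat \<lfloor>t\<rfloor>) = of_int \<lfloor>t\<rfloor>" by simp
  then show "t \<in> {real (nat \<lfloor>t\<rfloor>)..real (nat \<lfloor>t\<rfloor>) + 1}" by simp
qed

lemma E_Diff1: assumes "0 \<le> t" shows "E t \<in> Diff1"
proof -
  obtain k where k: "t \<in> {real k..real k + 1}" using unit_interval[OF assms] by blast
  show ?thesis unfolding E_eq[OF k] using k by (intro Diff1_compose Ft_Diff1 Diff1_funpow F_Diff1) auto
qed

lemma E_add_1: assumes "0 \<le> t" shows "E (t + 1) = E t \<circ> F"
proof -
  obtain k where k: "t \<in> {real k..real k + 1}" using unit_interval[OF assms] by blast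
  then have "t + 1 \<in> {real (Suc k)..real (Suc k) + 1}" by simp
  from E_eq[OF this] E_eq[OF k] show ?thesis by (simp add: fun_eq_iff funpow_swap1)
qed

lemma E_continuous:
  "continuous_on (UNIV \<times> {0..}) (\<lambda>(z, t). E t z)"
  "continuous_on (UNIV \<times> {0..}) (\<lambda>(z, t). DE t z)"
proof -
  have Fk: "F ^^ k \<in> Diff1" for k by (rule Diff1_funpow[OF F_Diff1])
  have "continuous_on (UNIV \<times> {real k..real k + 1}) (\<lambda>(z, t). Ft (t - real k) ((F ^^ k) z))" for k
    unfolding case_prod_unfold
    by (rule continuous_on_compose2[OF Ft_continuous(1), where f = "\<lambda>x. ((F ^^ k) (fst x), snd x - real k)", unfolded case_prod_unfold, simplified])
       (auto intro!: continuous_intros continuous_on_compose2[OF Diff1D(5)[OF Fk]])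
  then have "continuous_on (UNIV \<times> {real k..real k + 1}) (\<lambda>(z, t). E t z)" for k
    by (rule continuous_on_eq) (auto simp: E_eq[of _ k])
  then show "continuous_on (UNIV \<times> {0..}) (\<lambda>(z, t). E t z)"
    by (rule continuous_on_glue_unit_intervals)
  have "continuous_on (UNIV \<times> {real k..real k + 1})
      (\<lambda>(z, t). jacobian (Ft (t - real k)) (at ((F ^^ k) z)) ** jacobian (F ^^ k) (at z))" for k
    unfolding case_prod_unfold
    by (intro continuous_on_matrix_mult continuous_on_compose2[OF Diff1D(4)[OF Fk]] continuous_intros
         continuous_on_compose2[OF Ft_continuous(2), where f = "\<lambda>x. ((F ^^ k) (fst x), snd x - real k)", unfolded case_prod_unfold, simplified])
       (auto intro!: continuous_intros continuous_on_compose2[OF Diff1D(5)[OF Fk]])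
  then have "continuous_on (UNIV \<times> {real k..real k + 1}) (\<lambda>(z, t). DE t z)" for k
  proof (rule continuous_on_eq)
    fix x :: "plane \<times> real" assume "x \<in> UNIV \<times> {real k..real k + 1}"
    then obtain z t where x: "x = (z, t)" "t \<in> {real k..real k + 1}" by auto
    then have "Ft (t - real k) \<in> Diff1" by (intro Ft_Diff1) auto
    then show "(case x of (z, t) \<Rightarrow> jacobian (Ft (t - real k)) (at ((F ^^ k) z)) ** jacobian (F ^^ k) (at z)) =
        (case x of (z, t) \<Rightarrow> DE t z)"
      using jacobian_compose[OF Diff1D(3) Diff1D(3)[OF Fk]] by (simp add: x E_eq[OF x(2)])
  qed
  then show "continuous_on (UNIV \<times> {0..}) (\<lambda>(z, t). DE t z)"
    by (rule continuous_on_glue_unit_intervals)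
qed

lemma continuous_on_E [continuous_intros]:
  assumes "continuous_on S f" "continuous_on S g" "\<And>x. x \<in> S \<Longrightarrow> 0 \<le> g x"
  shows "continuous_on S (\<lambda>x. E (g x) (f x))" "continuous_on S (\<lambda>x. DE (g x) (f x))"
  using continuous_on_compose2[OF E_continuous(1) continuous_on_Pair[OF assms(1,2)]]
    continuous_on_compose2[OF E_continuous(2) continuous_on_Pair[OF assms(1,2)]] assms(3) by auto

lemma DE_nonzero: "0 \<le> t \<Longrightarrow> \<xi> \<noteq> 0 \<Longrightarrow> DE t z *v \<xi> \<noteq> 0"
  by (rule Diff1_jacobian_nonzero[OF E_Diff1])

lemma DE_0: "DE 0 z = mat 1"
  by (simp add: E_0 jacobian_id)

lemma DE_add_1: "0 \<le> t \<Longrightarrow> DE (t + 1) z = DE t (F z) ** jacobian F (at z)"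
  unfolding E_add_1 by (intro jacobian_compose Diff1D E_Diff1 F_Diff1)

end

section \<open>Torsion as a Birkhoff sum\<close>

lemma angle_variation_cong:
  assumes "\<And>t. 0 \<le> t \<Longrightarrow> w t = w' t"
  shows "angle_variation w = angle_variation w'"
proof -
  have "angle_lift w v \<longleftrightarrow> angle_lift w' v" for v using assms by (simp add: angle_lift_def)
  then show ?thesis by (simp add: angle_variation_def fun_eq_iff)
qed

context isotopy
begin

definition tangent_variation :: "plane \<Rightarrow> plane \<Rightarrow> real \<Rightarrow> real" where
  "tangent_variation z \<xi> t = angle_variation (\<lambda>t. DE t z *v \<xi>) t"

lemma torsion_n_eq: "torsion_n Ft z \<xi> n = tangent_variation z \<xi> (real n) / real n"
  by (simp add: torsion_n_def tangent_variation_def)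

lemma plane_curve_tangent: "\<xi> \<noteq> 0 \<Longrightarrow> plane_curve (\<lambda>t. DE t z *v \<xi>)"
  by unfold_locales (auto intro!: continuous_intros simp: DE_nonzero)

lemma continuous_on_tangent_variation:
  "continuous_on (UNIV \<times> (- {0})) (\<lambda>(z, \<xi>). tangent_variation z \<xi> (real n))"
proof -
  let ?S = "UNIV \<times> (- {0}) :: (plane \<times> plane) set"
  have "continuous_on (?S \<times> {0..}) (\<lambda>(p, t). DE t (fst p) *v snd p)"
    unfolding case_prod_unfold by (intro continuous_intros) auto
  note * = angle_variation_family(1)[OF this]
  have "continuous_on (?S \<times> {0..}) (\<lambda>(p, t). tangent_variation (fst p) (snd p) t)"
    unfolding tangent_variation_def by (rule *) (auto simp: DE_nonzero)
  then have "continuous_on ?S (\<lambda>p. (\<lambda>(p, t). tangent_variation (fst p) (snd p) t) (p, real n))"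
    by (rule continuous_on_compose2) (auto intro!: continuous_intros)
  then show ?thesis by (simp add: case_prod_unfold)
qed

lemma tangent_variation_scale:
  assumes "\<xi> \<noteq> 0" "c \<noteq> 0" "0 \<le> t"
  shows "tangent_variation z (c *\<^sub>R \<xi>) t = tangent_variation z \<xi> t"
  using plane_curve.angle_variation_scale[OF plane_curve_tangent[OF assms(1)] assms(2,3)]
  by (simp add: tangent_variation_def matrix_vector_mult_scaleR)

lemma tangent_variation_sgn: "\<xi> \<noteq> 0 \<Longrightarrow> 0 \<le> t \<Longrightarrow> tangent_variation z (sgn \<xi>) t = tangent_variation z \<xi> t"
  by (simp add: sgn_div_norm tangent_variation_scale)

text \<open>Proportional vectors have the same variation. Independent ones stay independent under
  the invertible derivatives, so the angle between them is trapped between consecutive multiples of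
  \<open>pi\<close>.\<close>

lemma tangent_variation_close:
  assumes "\<xi> \<noteq> 0" "\<eta> \<noteq> 0" "0 \<le> t"
  shows "\<bar>tangent_variation z \<xi> t - tangent_variation z \<eta> t\<bar> \<le> pi"
proof (cases "\<exists>c. \<eta> = c *\<^sub>R \<xi>")
  case True
  then obtain c where "\<eta> = c *\<^sub>R \<xi>" by blast
  then show ?thesis using assms by (simp add: tangent_variation_scale)
next
  case False
  show ?thesis unfolding tangent_variation_def
  proof (rule angle_variation_close[OF plane_curve_tangent[OF assms(1)] plane_curve_tangent[OF assms(2)] assms(3)])
    fix s c :: real assume "0 \<le> s"
    moreover have "\<eta> - c *\<^sub>R \<xi> \<noteq> 0" using False by auto
    ultimately have "DE s z *v (\<eta> - c *\<^sub>R \<xi>) \<noteq> 0" by (rule DE_nonzero)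
    then show "DE s z *v \<eta> \<noteq> c *\<^sub>R (DE s z *v \<xi>)"
      by (simp add: matrix_vector_mult_diff_distrib matrix_vector_mult_scaleR)
  qed
qed

text \<open>Defined on all pairs so that the results for Euclidean spaces apply; it preserves unit
  vectors, but need not be continuous at zero vectors.\<close>

definition tangent_map :: "plane \<times> plane \<Rightarrow> plane \<times> plane" where
  "tangent_map = (\<lambda>(z, \<xi>). (F z, sgn (jacobian F (at z) *v \<xi>)))"

lemma F_jacobian_nonzero: "\<xi> \<noteq> 0 \<Longrightarrow> jacobian F (at z) *v \<xi> \<noteq> 0"
  by (rule Diff1_jacobian_nonzero[OF F_Diff1])

text \<open>The cocycle identity, from \<open>E (t + 1)\<close> being \<open>E t\<close> after
  \<open>F\<close>. Normalising the transported vector is harmless because variation ignores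
  scaling.\<close>

lemma tangent_variation_Suc:
  assumes "\<xi> \<noteq> 0"
  shows "tangent_variation z \<xi> (real (Suc n)) = tangent_variation z \<xi> 1 +
    tangent_variation (F z) (sgn (jacobian F (at z) *v \<xi>)) (real n)"
proof -
  have "tangent_variation (F z) (jacobian F (at z) *v \<xi>) (real n) =
      angle_variation (\<lambda>t. DE (t + 1) z *v \<xi>) (real n)"
    unfolding tangent_variation_def
    by (intro fun_cong[OF angle_variation_cong]) (simp add: DE_add_1 matrix_vector_mul_assoc)
  also have "\<dots> = tangent_variation z \<xi> (real n + 1) - tangent_variation z \<xi> 1"
    unfolding tangent_variation_def
    by (rule plane_curve.angle_variation_shift[OF plane_curve_tangent[OF assms]]) auto
  finally show ?thesis
    using tangent_variation_sgn[OF F_jacobian_nonzero[OF assms], of "real n" "F z" z] by (simp add: add.commute)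
qed

lemma birkhoff_sum_tangent_variation:
  assumes "\<xi> \<noteq> 0"
  shows "birkhoff_sum tangent_map (\<lambda>(z, \<xi>). tangent_variation z \<xi> 1) n (z, \<xi>) = tangent_variation z \<xi> (real n)"
  using assms
proof (induction n arbitrary: z \<xi>)
  case 0
  then show ?case
    using plane_curve.angle_variation_0[OF plane_curve_tangent[OF 0]] by (simp add: tangent_variation_def)
next
  case (Suc n)
  have "sgn (jacobian F (at z) *v \<xi>) \<noteq> 0"
    using F_jacobian_nonzero[OF Suc.prems] by (simp add: sgn_zero_iff)
  from Suc.IH[OF this, of "F z"] show ?case
    unfolding birkhoff_sum_Suc by (subst tangent_variation_Suc[OF Suc.prems]) (simp add: tangent_map_def)
qed

lemma torsion_n_limit_independent:
  assumes "\<xi> \<noteq> 0" "\<eta> \<noteq> 0" and lim: "(\<lambda>n. torsion_n Ft z \<xi> n) \<longlonglongrightarrow> \<tau>"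
  shows "(\<lambda>n. torsion_n Ft z \<eta> n) \<longlonglongrightarrow> \<tau>"
proof -
  have "(\<lambda>n. torsion_n Ft z \<eta> n - torsion_n Ft z \<xi> n) \<longlonglongrightarrow> 0"
  proof (rule Lim_null_comparison)
    show "(\<lambda>n. pi / real n) \<longlonglongrightarrow> 0" by real_asymp
    show "\<forall>\<^sub>F n in sequentially. norm (torsion_n Ft z \<eta> n - torsion_n Ft z \<xi> n) \<le> pi / real n"
      unfolding torsion_n_eq diff_divide_distrib[symmetric]
      using tangent_variation_close[OF assms(2,1)]
      by (auto intro!: always_eventually divide_right_mono)
  qed
  from tendsto_add[OF this lim] show ?thesis by simp
qed

lemma has_torsion_iff:
  assumes "\<xi> \<noteq> 0"
  shows "has_torsion Ft z \<tau> \<longleftrightarrow> (\<lambda>n. torsion_n Ft z \<xi> n) \<longlonglongrightarrow> \<tau>"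
  unfolding has_torsion_def using torsion_n_limit_independent assms by blast

text \<open>Both sides describe the same predicate by \<open>THE\<close>, so they agree even where
  no limit exists; \<open>torsion Ft\<close> is therefore Borel on the whole plane.\<close>

lemma torsion_eq_lim:
  assumes "\<xi> \<noteq> 0"
  shows "torsion Ft z = lim (\<lambda>n. torsion_n Ft z \<xi> n)"
  by (simp add: torsion_def lim_def has_torsion_iff[OF assms])

lemma torsion_eqI: "has_torsion Ft z \<tau> \<Longrightarrow> torsion Ft z = \<tau>"
  using torsion_eq_lim has_torsion_iff limI zero_neq_one[where 'a = plane] by metis

section \<open>Borel measurability of the torsion\<close>

lemma borel_measurable_torsion_n:
  assumes "\<xi> \<noteq> 0"
  shows "(\<lambda>z. torsion_n Ft z \<xi> n) \<in> borel_measurable borel"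
proof -
  have "continuous_on UNIV (\<lambda>z. (\<lambda>(z, \<xi>). tangent_variation z \<xi> (real n)) (z, \<xi>))"
    by (rule continuous_on_compose2[OF continuous_on_tangent_variation]) (use assms in \<open>auto intro!: continuous_intros\<close>)
  from borel_measurable_continuous_onI[OF this]
  show ?thesis unfolding torsion_n_eq by simp
qed

lemma borel_measurable_torsion: "torsion Ft \<in> borel_measurable borel"
proof -
  have 1: "(1 :: plane) \<noteq> 0" by simp
  have "torsion Ft = (\<lambda>z. lim (\<lambda>n. torsion_n Ft z 1 n))"
    using torsion_eq_lim[OF 1] by blast
  moreover have "(\<lambda>z. lim (\<lambda>n. torsion_n Ft z 1 n)) \<in> borel_measurable borel"
    by (rule borel_measurable_lim_metric) (rule borel_measurable_torsion_n[OF 1])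
  ultimately show ?thesis by simp
qed

lemma sets_torsion_exists: "{z. torsion_exists Ft z} \<in> sets borel"
proof -
  have 1: "(1 :: plane) \<noteq> 0" by simp
  have "{z \<in> space borel. Cauchy (\<lambda>n. torsion_n Ft z 1 n)} \<in> sets borel"
    by (rule sets_Collect_Cauchy) (rule borel_measurable_torsion_n[OF 1])
  moreover have "torsion_exists Ft z \<longleftrightarrow> Cauchy (\<lambda>n. torsion_n Ft z 1 n)" for z
    unfolding torsion_exists_def has_torsion_iff[OF 1] Cauchy_convergent_iff convergent_def ..
  ultimately show ?thesis by simp
qed

text \<open>\<open>G\<close> is the difference quotient in Hadamard's integral form, which extends
  continuously to tangent vectors on the diagonal. It never vanishes: off the diagonal by
  injectivity of \<open>E t\<close>, on it by invertibility of the derivative.\<close>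

lemma torsion_n_eq_linking_n:
  assumes "x \<noteq> y"
  shows "\<exists>z \<in> closed_segment x y. torsion_n Ft z (y - x) n = linking_n Ft x y n"
proof -
  define \<gamma> where "\<gamma> s = x + s *\<^sub>R (y - x)" for s
  define G where "G p t = integral (cbox 0 1) (\<lambda>r. DE t (\<gamma> (fst p + r * (snd p - fst p))) *v (y - x))"
    for p :: "real \<times> real" and t
  have "continuous_on ((UNIV \<times> {0..}) \<times> cbox 0 1)
      (\<lambda>(q, r). DE (snd q) (\<gamma> (fst (fst q) + r * (snd (fst q) - fst (fst q)))) *v (y - x))"
    unfolding case_prod_unfold \<gamma>_def by (intro continuous_intros) auto
  from integral_continuous_on_param[OF this]
  have cG: "continuous_on (UNIV \<times> {0..}) (\<lambda>(p, t). G p t)"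
    unfolding G_def case_prod_unfold .
  have chord: "(s - s') *\<^sub>R G (s', s) t = E t (\<gamma> s) - E t (\<gamma> s')" if "0 \<le> t" for s s' t
  proof -
    have "((\<lambda>r. E t (\<gamma> (s' + r * (s - s')))) has_vector_derivative
        (s - s') *\<^sub>R (DE t (\<gamma> (s' + r * (s - s'))) *v (y - x))) (at r within {0..1})" for r
    proof -
      have "((\<lambda>r. \<gamma> (s' + r * (s - s'))) has_vector_derivative (s - s') *\<^sub>R (y - x)) (at r within {0..1})"
        unfolding \<gamma>_def by (auto intro!: derivative_eq_intros simp: has_vector_derivative_def algebra_simps)
      from vector_derivative_diff_chain_within[OF this has_derivative_at_withinI[OF jacobian_has_derivative[OF Diff1D(3)[OF E_Diff1[OF that]]]]]
      show ?thesis by (simp add: o_def matrix_vector_mult_scaleR)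
    qed
    then have "((\<lambda>r. (s - s') *\<^sub>R (DE t (\<gamma> (s' + r * (s - s'))) *v (y - x))) has_integral
        E t (\<gamma> (s' + 1 * (s - s'))) - E t (\<gamma> (s' + 0 * (s - s')))) {0..1}"
      by (intro fundamental_theorem_of_calculus) auto
    from integral_unique[OF this] show ?thesis by (simp add: G_def)
  qed
  have diag: "G (s, s) t = DE t (\<gamma> s) *v (y - x)" for s t by (simp add: G_def)
  have nz: "G p t \<noteq> 0" if "0 \<le> t" for p t
  proof (cases "fst p = snd p")
    case True
    then show ?thesis using diag[of "fst p" t] DE_nonzero[OF that, of "y - x"] assms by (metis prod.collapse right_minus_eq)
  next
    case False
    then have "\<gamma> (snd p) \<noteq> \<gamma> (fst p)" using assms by (simp add: \<gamma>_def)
    then have "E t (\<gamma> (snd p)) \<noteq> E t (\<gamma> (fst p))"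
      using Diff1D(2)[OF E_Diff1[OF that]] by (simp add: inj_eq)
    then show ?thesis using chord[OF that, of "snd p" "fst p"] by auto
  qed
  have G0: "G p 0 = y - x" for p by (simp add: G_def DE_0)
  \<comment> \<open>All members of the family start at \<open>y - x\<close>, so with this common
    offset equal values of \<open>a\<close> mean equal variations.\<close>
  define a where "a s' s = Arg (cpx (y - x)) + angle_variation (G (s', s)) (real n)" for s' s
  have fam: "continuous_on (UNIV \<times> {0..}) (\<lambda>(p, t). angle_variation (G p) t)"
    "\<And>p. sgn (cpx (G p (real n))) = sgn (cpx (y - x)) * cis (angle_variation (G p) (real n))"
    using angle_variation_family[OF cG nz] G0 by auto
  have polar: "norm (G (s', s) (real n)) *\<^sub>R cis (a s' s) = cpx (G (s', s) (real n))" for s' s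
  proof -
    have "cis (a s' s) = sgn (cpx (G (s', s) (real n)))"
      unfolding fam(2) a_def cis_mult[symmetric] using assms by (simp add: cis_Arg)
    then show ?thesis using nz[of "real n" "(s', s)"] by (simp add: sgn_div_norm)
  qed
  have "chord_angles (\<lambda>s' s. norm (G (s', s) (real n))) a 0 1"
    unfolding chord_angles_def
  proof (intro conjI allI impI)
    have "continuous_on {(m, m'). 0 \<le> m \<and> m \<le> m' \<and> m' \<le> (1::real)} (\<lambda>p. (\<lambda>(p, t). angle_variation (G p) t) (p, real n))"
      by (rule continuous_on_compose2[OF fam(1)]) (auto intro!: continuous_intros)
    then show "continuous_on {(m, m'). 0 \<le> m \<and> m \<le> m' \<and> m' \<le> 1} (\<lambda>(m, m'). a m m')"
      unfolding a_def case_prod_unfold by (auto intro!: continuous_intros)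
    show "norm (G (m, m') (real n)) > 0" for m m' using nz by simp
    have c: "((s - s') * norm (G (s', s) (real n))) *\<^sub>R cis (a s' s)
        = cpx (E (real n) (\<gamma> s)) - cpx (E (real n) (\<gamma> s'))" for s s'
      using arg_cong[OF chord[of "real n" s s'], of cpx] polar[of s' s]
      by (simp add: cpx_simps flip: scaleR_scaleR)
    show "((m'' - m) * norm (G (m, m'') (real n))) *\<^sub>R cis (a m m'') =
        ((m' - m) * norm (G (m, m') (real n))) *\<^sub>R cis (a m m') +
        ((m'' - m') * norm (G (m', m'') (real n))) *\<^sub>R cis (a m' m'')" for m m' m''
      unfolding c by simp
  qed
  then obtain s where s: "0 \<le> s" "s \<le> 1" "a s s = a 0 1"
    using chord_angle_mean_value[of _ a 0 1] by auto
  have "G (0, 1) t = E t y - E t x" if "0 \<le> t" for t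
    using chord[OF that, of 1 0] by (simp add: \<gamma>_def)
  then have "angle_variation (G (0, 1)) = angle_variation (\<lambda>t. E t y - E t x)"
    by (intro angle_variation_cong) auto
  moreover have "angle_variation (G (s, s)) = angle_variation (\<lambda>t. DE t (\<gamma> s) *v (y - x))"
    by (intro angle_variation_cong diag)
  ultimately have "torsion_n Ft (\<gamma> s) (y - x) n = linking_n Ft x y n"
    using s(3) by (simp add: a_def torsion_n_def linking_n_def)
  moreover have "\<gamma> s \<in> closed_segment x y"
    using s by (auto simp: \<gamma>_def in_segment algebra_simps intro!: exI[of _ s])
  ultimately show ?thesis by blast
qed

end

theorem corollary3p2:
  fixes Ft :: "real \<Rightarrow> plane \<Rightarrow> plane" and F :: "plane \<Rightarrow> plane" and x y :: plane and l :: real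
  assumes "isotopy_from_id Ft F"
    and "x \<noteq> y"
    and "has_linking Ft x y l"
    and "compact (closure (\<Union>n::nat. (F ^^ n) ` closed_segment x y))"
  shows "(\<exists>\<mu>. invariant_borel_prob F \<mu> \<and> has_measure_torsion Ft \<mu> l) \<and>
         (\<exists>z. torsion_exists Ft z \<and> torsion Ft z \<ge> l) \<and>
         (\<exists>z. torsion_exists Ft z \<and> torsion Ft z \<le> l)"
proof -
  interpret isotopy Ft F by unfold_locales fact
  let ?O = "\<Union>n::nat. (F ^^ n) ` closed_segment x y"
  let ?K = "closure ?O" and ?T = tangent_map and ?b = "\<lambda>(z, \<xi>). tangent_variation z \<xi> 1"
  let ?C = "?K \<times> sphere (0 :: plane) 1"
  note cF = Diff1D(5)[OF F_Diff1] and cDF = Diff1D(4)[OF F_Diff1]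
  have FK: "F z \<in> ?K" if "z \<in> ?K" for z
  proof -
    have "F ` ?O \<subseteq> ?O" (is ?FO)
    proof clarify
      fix n p assume "p \<in> closed_segment x y"
      then have "(F ^^ Suc n) p \<in> ?O" by blast
      then show "F ((F ^^ n) p) \<in> ?O" by simp
    qed
    then have "F ` ?K \<subseteq> ?K"
      by (intro image_closure_subset continuous_on_subset[OF cF] order_trans[OF \<open>?FO\<close> closure_subset]) auto
    then show ?thesis using that by blast
  qed
  have C: "compact ?C" using assms(4) by (intro compact_Times compact_sphere)
  have CS: "?C \<subseteq> UNIV \<times> (- {0})" by auto
  have TC: "?T \<in> ?C \<rightarrow> ?C"
  proof
    fix p assume "p \<in> ?C"
    then obtain z \<xi> where p: "p = (z, \<xi>)" "z \<in> ?K" "norm \<xi> = 1" by auto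
    then have "jacobian F (at z) *v \<xi> \<noteq> 0" by (intro F_jacobian_nonzero) auto
    then show "?T p \<in> ?C" using p FK by (simp add: tangent_map_def norm_sgn)
  qed
  have DFnz: "jacobian F (at z) *v \<xi> \<noteq> 0" if "norm \<xi> = 1" for z \<xi>
    by (rule F_jacobian_nonzero) (use that in auto)
  have cT: "continuous_on ?C ?T"
    unfolding tangent_map_def case_prod_unfold sgn_div_norm
    by (intro continuous_intros continuous_on_compose2[OF cF] continuous_on_compose2[OF cDF])
       (use DFnz in auto)
  have Tm: "?T \<in> borel_measurable borel"
  proof -
    let ?D = "\<lambda>p :: plane \<times> plane. jacobian F (at (fst p)) *v snd p"
    have "continuous_on UNIV ?D"
      by (intro continuous_intros continuous_on_compose2[OF cDF]) auto
    then have D: "?D \<in> borel_measurable borel" by (rule borel_measurable_continuous_onI)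
    then have N: "(\<lambda>p. norm (?D p)) \<in> borel_measurable borel" by measurable
    have "continuous_on UNIV (\<lambda>p :: plane \<times> plane. F (fst p))"
      by (intro continuous_intros continuous_on_compose2[OF cF]) auto
    then have "(\<lambda>p :: plane \<times> plane. F (fst p)) \<in> borel_measurable borel"
      by (rule borel_measurable_continuous_onI)
    \<comment> \<open>Although discontinuous at 0, \<open>sgn\<close> is Borel as the vector divided
      by its norm.\<close>
    then have "(\<lambda>p. (F (fst p), sgn (?D p))) \<in> borel_measurable borel"
      unfolding sgn_div_norm
      by (intro borel_measurable_Pair borel_measurable_scaleR borel_measurable_inverse N D)
    then show ?thesis by (simp add: tangent_map_def case_prod_unfold)
  qed
  have cb: "continuous_on ?C ?b"
    using continuous_on_subset[OF continuous_on_tangent_variation[of 1] CS] by simp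
  obtain \<zeta> where \<zeta>: "\<And>n. \<zeta> n \<in> closed_segment x y" "\<And>n. torsion_n Ft (\<zeta> n) (y - x) n = linking_n Ft x y n"
    using torsion_n_eq_linking_n[OF assms(2)] by metis
  let ?\<xi> = "sgn (y - x)"
  have xy: "y - x \<noteq> 0" "?\<xi> \<noteq> 0" using assms(2) by (auto simp: sgn_zero_iff)
  have "(F ^^ 0) ` closed_segment x y \<subseteq> ?O" by blast
  then have "closed_segment x y \<subseteq> ?O" by (simp only: funpow.simps(1) image_id id_apply)
  then have zC: "(\<zeta> n, ?\<xi>) \<in> ?C" for n
    using \<zeta>(1)[of n] closure_subset[of ?O] xy(1) by (auto simp: norm_sgn)
  have "birkhoff_sum ?T ?b n (\<zeta> n, ?\<xi>) / n = linking_n Ft x y n" for n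
    unfolding birkhoff_sum_tangent_variation[OF xy(2)] \<zeta>(2)[symmetric] torsion_n_eq
    by (simp add: tangent_variation_sgn[OF xy(1)])
  then have lim: "(\<lambda>n. birkhoff_sum ?T ?b n (\<zeta> n, ?\<xi>) / n) \<longlonglongrightarrow> l"
    using assms(3) by (simp add: has_linking_def)
  obtain \<nu> L B where \<nu>: "sets \<nu> = sets borel" "prob_space \<nu>" "distr \<nu> borel ?T = \<nu>" "AE p in \<nu>. p \<in> ?C"
    and L: "L \<in> borel_measurable borel" "\<And>p. \<bar>L p\<bar> \<le> (B::real)"
      "AE p in \<nu>. (\<lambda>n. birkhoff_sum ?T ?b n p / n) \<longlonglongrightarrow> L p" "(\<integral>p. L p \<partial>\<nu>) = l"
    by (rule invariant_measure_of_birkhoff_averages[OF C TC cT Tm cb zC lim]) blast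
  interpret \<nu>: prob_space \<nu> by fact
  note [measurable_cong] = \<nu>(1)
  note L(1) [measurable] and Tm [measurable] and borel_measurable_torsion [measurable] and sets_torsion_exists [measurable]
  have Fm [measurable]: "F \<in> borel_measurable borel" using cF by (rule borel_measurable_continuous_onI)
  have fm [measurable]: "fst \<in> borel_measurable (borel :: (plane \<times> plane) measure)"
    by (intro borel_measurable_continuous_onI continuous_intros)
  \<comment> \<open>The average converges in the direction \<open>snd p\<close>, and the torsion may
    be computed in any direction.\<close>
  have tor: "AE p in \<nu>. has_torsion Ft (fst p) (L p)"
    using \<nu>(4) L(3)
  proof eventually_elim
    case (elim p)
    then have "snd p \<noteq> 0" by auto
    then obtain z \<xi> where p: "p = (z, \<xi>)" "\<xi> \<noteq> 0" by (cases p) simp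
    show ?case using elim(2)
      unfolding p has_torsion_iff[OF p(2)] birkhoff_sum_tangent_variation[OF p(2)] torsion_n_eq by simp
  qed
  define \<mu> where "\<mu> = distr \<nu> borel fst"
  have \<mu>: "sets \<mu> = sets borel" "prob_space \<mu>"
    unfolding \<mu>_def by (auto intro: \<nu>.prob_space_distr)
  interpret \<mu>: prob_space \<mu> by fact
  \<comment> \<open>The projection \<open>fst\<close> intertwines \<open>tangent_map\<close> and
    \<open>F\<close>, so invariance descends.\<close>
  have "distr \<mu> borel F = distr \<nu> borel (\<lambda>p. F (fst p))"
    unfolding \<mu>_def by (subst distr_distr) (auto simp: o_def)
  also have "\<dots> = distr \<nu> borel (\<lambda>p. fst (?T p))" by (simp add: tangent_map_def case_prod_unfold)
  also have "\<dots> = distr (distr \<nu> borel ?T) borel fst" by (subst distr_distr) (auto simp: o_def)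
  finally have inv: "invariant_borel_prob F \<mu>" using \<mu> \<nu>(3) by (simp add: invariant_borel_prob_def \<mu>_def)
  have AEK: "AE z in \<mu>. z \<in> ?K"
    unfolding \<mu>_def by (subst AE_distr_iff) (use \<nu>(4) in \<open>auto elim: eventually_mono\<close>)
  have "compact (measure_support \<mu>)"
  proof -
    have "closed (measure_support \<mu>)"
    proof -
      have "- measure_support \<mu> = \<Union>{U. open U \<and> emeasure \<mu> U = 0}"
        by (auto simp: measure_support_def)
      then have "open (- measure_support \<mu>)" by auto
      then show ?thesis by (simp add: closed_def)
    qed
    \<comment> \<open>The complement of \<open>?K\<close> is an open null set.\<close>
    moreover have "measure_support \<mu> \<subseteq> ?K"
    proof
      fix z assume z: "z \<in> measure_support \<mu>"
      have "emeasure \<mu> {z \<in> space \<mu>. z \<notin> ?K} = 0"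
        by (rule emeasure_eq_0_AE) (use AEK in simp)
      moreover have "{z \<in> space \<mu>. z \<notin> ?K} = - ?K"
        using sets_eq_imp_space_eq[OF \<mu>(1)] by auto
      ultimately have "emeasure \<mu> (- ?K) = 0" by simp
      moreover have "\<forall>U. open U \<and> z \<in> U \<longrightarrow> emeasure \<mu> U > 0" using z by (simp add: measure_support_def)
      moreover have "open (- ?K)" by (rule open_Compl[OF closed_closure])
      ultimately have "z \<notin> - ?K" by (metis less_irrefl)
      then show "z \<in> ?K" by simp
    qed
    ultimately show ?thesis using compact_Int_closed[OF assms(4)] by (metis Int_absorb1)
  qed
  moreover have AEex: "AE z in \<mu>. torsion_exists Ft z"
  proof -
    have "AE p in \<nu>. torsion_exists Ft (fst p)"
      using tor by eventually_elim (auto simp: torsion_exists_def)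
    then show ?thesis
      unfolding \<mu>_def by (subst AE_distr_iff) (simp_all add: sets_torsion_exists)
  qed
  moreover have torL: "AE p in \<nu>. torsion Ft (fst p) = L p"
    using tor by eventually_elim (rule torsion_eqI)
  have "integrable \<nu> L" by (rule \<nu>.integrable_const_bound[where B = B]) (use L(2) in auto)
  then have "integrable \<nu> (\<lambda>p. torsion Ft (fst p))"
    by (rule integrable_cong_AE_imp) (use torL in \<open>auto elim: eventually_mono\<close>)
  then have int: "integrable \<mu> (torsion Ft)" unfolding \<mu>_def by (subst integrable_distr_eq) auto
  moreover have l: "(\<integral>z. torsion Ft z \<partial>\<mu>) = l"
  proof -
    have "(\<integral>z. torsion Ft z \<partial>\<mu>) = (\<integral>p. torsion Ft (fst p) \<partial>\<nu>)"
      unfolding \<mu>_def by (rule integral_distr) auto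
    also have "\<dots> = (\<integral>p. L p \<partial>\<nu>)" by (rule integral_cong_AE) (use torL in auto)
    finally show ?thesis using L(4) by simp
  qed
  ultimately have "has_measure_torsion Ft \<mu> l" by (simp add: has_measure_torsion_def)
  moreover have "\<exists>z. torsion_exists Ft z \<and> torsion Ft z \<ge> l"
  proof (rule ccontr)
    assume "\<not> ?thesis"
    \<comment> \<open>Under a probability measure, a function almost everywhere below
      \<open>l\<close> cannot have integral \<open>l\<close>.\<close>
    then have "AE z in \<mu>. torsion Ft z < l" using AEex by (auto elim!: eventually_mono simp: not_le)
    then have "(\<integral>z. torsion Ft z \<partial>\<mu>) < (\<integral>z. l \<partial>\<mu>)"
      using int by (intro \<mu>.integral_less_AE_space) (auto simp: \<mu>.emeasure_space_1)
    then show False using l by (simp add: \<mu>.prob_space)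
  qed
  moreover have "\<exists>z. torsion_exists Ft z \<and> torsion Ft z \<le> l"
  proof (rule ccontr)
    assume "\<not> ?thesis"
    then have "AE z in \<mu>. l < torsion Ft z" using AEex by (auto elim!: eventually_mono simp: not_le)
    then have "(\<integral>z. l \<partial>\<mu>) < (\<integral>z. torsion Ft z \<partial>\<mu>)"
      using int by (intro \<mu>.integral_less_AE_space) (auto simp: \<mu>.emeasure_space_1)
    then show False using l by (simp add: \<mu>.prob_space)
  qed
  ultimately show ?thesis using inv by blast
qed

end
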